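(* Let $G$ be a $2$-connected bipartite subcubic outerplanar graph. Then $\chi_{\rho}(G)\le 7$.
   Context: All graphs are finite and simple. A graph is subcubic if every vertex has degree at most $3$. A graph is outerplanar if it has a planar drawing in which all vertices lie on the outer face. For a positive integer $d$, a set $A\subseteq V(G)$ is a $d$-packing if any two distinct vertices of $A$ are at distance greater than $d$ in $G$. For a nondecreasing sequence $S=(s_1,\ldots,s_k)$ of positive integers, an $S$-packing coloring of $G$ is a map $c:V(G)\to\{1,\ldots,k\}$ such that for every $i$, the set $c^{-1}(i)$ is an $s_i$-packing. The packing chromatic number $\chi_\rho(G)$ is the smallest $k$ such that $G$ admits a $(1,2,\ldots,k)$-packing coloring (i.e., vertices of color $i$ are pairwise at distance greater than $i$). *)

theory Defs
  imports "HOL-Analysis.Analysis" "Graph_Theory.Graph_Theory"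
begin

text \<open>
  A finite simple graph is a \<^locale>\<open>pair_graph\<close>: an undirected edge \<open>uv\<close> is represented by the two
  arcs \<open>(u, v)\<close> and \<open>(v, u)\<close>, so the degree of a vertex is its out-degree.
\<close>

definition subcubic :: "'a pair_pre_digraph \<Rightarrow> bool" where
  "subcubic G \<longleftrightarrow> (\<forall>v \<in> pverts G. out_degree G v \<le> 3)"

definition bipartite :: "'a pair_pre_digraph \<Rightarrow> bool" where
  "bipartite G \<longleftrightarrow>
     (\<exists>U W. pverts G = U \<union> W \<and> U \<inter> W = {} \<and> parcs G \<subseteq> U \<times> W \<union> W \<times> U)"

text \<open>
  As usual, a \<open>k\<close>-connected graph has more than \<open>k\<close> vertices and cannot be disconnected by removing
  fewer than \<open>k\<close> vertices; so \<open>K\<^sub>2\<close> is not 2-connected.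
\<close>

definition k_connected :: "nat \<Rightarrow> 'a pair_pre_digraph \<Rightarrow> bool" where
  "k_connected k G \<longleftrightarrow> card (pverts G) > k \<and>
     (\<forall>X \<subseteq> pverts G. card X < k \<longrightarrow> Digraph_Component.connected (with_proj G \<restriction> (pverts G - X)))"

text \<open>
  A planar drawing places the vertices at distinct points of the plane and draws each edge as a
  simple arc between its ends, containing no other vertex and meeting other edges only in points
  of common ends. The two arcs of an edge are the same curve, traversed in opposite directions.
\<close>

definition planar_drawing ::
    "'a pair_pre_digraph \<Rightarrow> ('a \<Rightarrow> complex) \<Rightarrow> ('a \<times> 'a \<Rightarrow> real \<Rightarrow> complex) \<Rightarrow> bool" where
  "planar_drawing G p \<gamma> \<longleftrightarrow>
     inj_on p (pverts G) \<and>
     (\<forall>(u, v) \<in> parcs G.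
        Path_Connected.arc (\<gamma> (u, v)) \<and> pathstart (\<gamma> (u, v)) = p u \<and> pathfinish (\<gamma> (u, v)) = p v \<and>
        \<gamma> (v, u) = reversepath (\<gamma> (u, v)) \<and>
        path_image (\<gamma> (u, v)) \<inter> p ` pverts G = {p u, p v}) \<and>
     (\<forall>(u, v) \<in> parcs G. \<forall>(x, y) \<in> parcs G. {u, v} \<noteq> {x, y} \<longrightarrow>
        path_image (\<gamma> (u, v)) \<inter> path_image (\<gamma> (x, y)) \<subseteq> p ` ({u, v} \<inter> {x, y}))"

definition drawing_points ::
    "'a pair_pre_digraph \<Rightarrow> ('a \<Rightarrow> complex) \<Rightarrow> ('a \<times> 'a \<Rightarrow> real \<Rightarrow> complex) \<Rightarrow> complex set" where
  "drawing_points G p \<gamma> = p ` pverts G \<union> (\<Union>e \<in> parcs G. path_image (\<gamma> e))"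

text \<open>
  The outer face of a drawing is the unbounded component of its complement, which is
  \<^const>\<open>outside\<close> of the (bounded) set of its points; a vertex lies on the outer face if it is on the
  boundary of that component.
\<close>

definition outerplanar :: "'a pair_pre_digraph \<Rightarrow> bool" where
  "outerplanar G \<longleftrightarrow>
     (\<exists>p \<gamma>. planar_drawing G p \<gamma> \<and> p ` pverts G \<subseteq> frontier (outside (drawing_points G p \<gamma>)))"

text \<open>
  With unit weights, \<open>\<mu>\<close> is the usual graph distance, and it is \<open>\<infinity>\<close> between different components.
\<close>

definition graph_dist :: "'a pair_pre_digraph \<Rightarrow> 'a \<Rightarrow> 'a \<Rightarrow> ereal" where
  "graph_dist G u v = wf_digraph.\<mu> (with_proj G) (\<lambda>_. 1) u v"

definition d_packing :: "'a pair_pre_digraph \<Rightarrow> nat \<Rightarrow> 'a set \<Rightarrow> bool" where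
  "d_packing G d A \<longleftrightarrow> A \<subseteq> pverts G \<and>
     (\<forall>u \<in> A. \<forall>v \<in> A. u \<noteq> v \<longrightarrow> graph_dist G u v > ereal (real d))"

text \<open>\<open>S_packing_coloring G k s c\<close>: \<open>c\<close> is an \<open>(s 1, \<dots>, s k)\<close>-packing coloring of \<open>G\<close>.\<close>

definition S_packing_coloring ::
    "'a pair_pre_digraph \<Rightarrow> nat \<Rightarrow> (nat \<Rightarrow> nat) \<Rightarrow> ('a \<Rightarrow> nat) \<Rightarrow> bool" where
  "S_packing_coloring G k s c \<longleftrightarrow> c ` pverts G \<subseteq> {1..k} \<and>
     (\<forall>i \<in> {1..k}. d_packing G (s i) {v \<in> pverts G. c v = i})"

definition packing_chromatic_number :: "'a pair_pre_digraph \<Rightarrow> nat" where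
  "packing_chromatic_number G = (LEAST k. \<exists>c. S_packing_coloring G k (\<lambda>i. i) c)"

text \<open>The minimum is attained, since an injective coloring is always admissible.\<close>

lemma packing_coloring_exists:
  assumes "finite (pverts G)"
  shows "\<exists>c. S_packing_coloring G (packing_chromatic_number G) (\<lambda>i. i) c"
proof -
  obtain c where c: "bij_betw c (pverts G) {1..card (pverts G)}"
    using assms finite_same_card_bij[of "pverts G" "{1..card (pverts G)}"] by auto
  have "S_packing_coloring G (card (pverts G)) (\<lambda>i. i) c"
    using c unfolding S_packing_coloring_def d_packing_def bij_betw_def
    by (auto dest: inj_onD)
  then show ?thesis
    unfolding packing_chromatic_number_def
    by (intro LeastI_ex[where P = "\<lambda>k. \<exists>c. S_packing_coloring G k (\<lambda>i. i) c"]) blast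
qed

end

theory Submission
  imports Defs
begin

text \<open>
  Outerplanarity excludes a subdivided \<open>K\<^sub>2\<^sub>,\<^sub>3\<close>: by the Jordan curve theorem and Janiszewski's theorem,
  three arcs with common ends cannot all have an interior point on the outer face. Hence a longest
  cycle of a 2-connected graph is Hamiltonian, and bipartiteness makes its chords non-crossing.
  Such a graph of maximum degree 3 arises from a single edge by attaching paths to the two ends of
  edges whose ends have degree at most 2 (remove the inner vertices below a shortest chord).

  Let \<open>A\<close>, \<open>B\<close> be the colour classes. All of \<open>A\<close> gets colour 1. The vertices of \<open>B\<close> are split by \<open>\<kappa>\<close>
  into three classes such that the neighbours of any \<open>A\<close>-vertex are in distinct classes; classes 0
  and 1 get colours 2 and 3. Class 2 gets the colours 4, 5 and 6/7 by means of a label \<open>\<xi>\<close> in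
  \<open>{0, 1, 2}\<close> on \<open>A\<close>, constant around a vertex of class 2 and injective around the other vertices of
  \<open>B\<close>, so that equal labels are at distance at least 6. Label 2 is split into the colours 6 and 7 by
  a sign \<open>s\<close> on \<open>B\<close>, which is kept across \<open>A\<close>-vertices of label 2 and flipped between vertices of
  the classes 0 and 1 across the other \<open>A\<close>-vertices; this rules out distance 6. The
  conditions are local enough to be extended along every attached path.
\<close>

section \<open>Theta curves with all arcs on the outer face\<close>

text \<open>Vertices of \<open>B\<close> are joined only by walks of even length, so the colours 2
  and 3 have to exclude distance 2, the colours 4 and 5 also distance 4, and the colours 6 and 7
  also distance 6: classes, labels and signs are responsible for one of these distances each. The
  labels sit on \<open>A\<close> rather than on class 2, because a label at an
  \<open>A\<close>-vertex without a class-2 neighbour then reserves a colour for such a neighbour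
  attached later. The obstacle is that an attached path closes a face: class and sign are prescribed
  at \<open>b\<^sub>0\<close>, where it starts and ends, and around a face without class 2 the
  number of sign flips has to be even. A class-2 vertex whose neighbours have a label other than 2
  interrupts this chain of signs. Faces of length 4 and 6 leave too little room even for that, which
  forces exceptions to the rules; they do no harm, since the vertices involved share a class-2
  neighbour and a short walk through them would have to return to its start.\<close>

lemma jordan_union:
  fixes g h :: "real \<Rightarrow> complex"
  assumes "arc g" "pathstart g = a" "pathfinish g = b" 
    and "arc h" "pathstart h = a" "pathfinish h = b" 
    and "path_image g \<inter> path_image h = {a, b}"
  defines "J \<equiv> path_image g \<union> path_image h"
  shows "inside J \<noteq> {}" "Topological_Spaces.connected (inside J)" "Topological_Spaces.connected (outside J)" 
    "inside J \<inter> outside J = {}" "inside J \<union> outside J = - J" "frontier (inside J) = J" 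
    "frontier (outside J) = J" "open (inside J)" "open (outside J)"
proof -
  have 1: "simple_path (g +++ reversepath h)"
    using assms by (intro simple_path_join_loop) (auto simp: arc_reversepath)
  have 2: "pathfinish (g +++ reversepath h) = pathstart (g +++ reversepath h)"
    using assms by simp
  have 3: "path_image (g +++ reversepath h) = J"
    using assms by (simp add: path_image_join)
  show "inside J \<noteq> {}" "Topological_Spaces.connected (inside J)" "Topological_Spaces.connected (outside J)" 
    "inside J \<inter> outside J = {}" "inside J \<union> outside J = - J" "frontier (inside J) = J" 
    "frontier (outside J) = J" "open (inside J)" "open (outside J)"
    using Jordan_inside_outside[OF 1 2] unfolding 3 by auto
qed

lemma connected_endless_arc:
  fixes g :: "real \<Rightarrow> complex"
  assumes "arc g"
  shows "Topological_Spaces.connected (path_image g - {pathstart g, pathfinish g})"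
  using assms connected_simple_path_endless arc_imp_simple_path by blast

text \<open>As \<open>outside D\<close> lies in the outside of the closed curve, a frontier point of
  it that is not on the curve is outside too. The arc without its ends is connected and misses the
  curve, so all of it follows \<open>m\<close>.\<close>

lemma arc_third_outside:
  fixes g h k :: "real \<Rightarrow> complex"
  assumes g: "arc g" "pathstart g = a" "pathfinish g = b" 
    and h: "arc h" "pathstart h = a" "pathfinish h = b" 
    and k: "arc k" "pathstart k = a" "pathfinish k = b" 
    and gh: "path_image g \<inter> path_image h = {a, b}"
    and gk: "path_image g \<inter> path_image k = {a, b}"
    and hk: "path_image h \<inter> path_image k = {a, b}"
    and D: "path_image g \<union> path_image h \<union> path_image k \<subseteq> D"
    and m: "m \<in> path_image k" "m \<noteq> a" "m \<noteq> b" "m \<in> frontier (outside D)"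
  shows "path_image k - {a, b} \<subseteq> outside (path_image g \<union> path_image h)"
proof -
  let ?J = "path_image g \<union> path_image h"
  note J = jordan_union[OF g h gh]
  have "outside D \<subseteq> outside ?J" using D by (intro outside_mono) auto
  then have "closure (outside D) \<subseteq> closure (outside ?J)" by (rule closure_mono)
  then have "m \<in> closure (outside ?J)" using m(4) by (auto simp: frontier_def)
  then have "m \<in> outside ?J \<union> ?J" using J(7) closure_Un_frontier[of "outside ?J"] by auto
  moreover have "m \<notin> ?J" using m gk hk by auto
  ultimately have mo: "m \<in> outside ?J" by auto
  have con: "Topological_Spaces.connected (path_image k - {a, b})" using connected_endless_arc[OF k(1)] k by simp
  have "path_image k - {a, b} \<subseteq> inside ?J \<union> outside ?J" using J(5) gk hk by auto
  then have "path_image k - {a, b} \<subseteq> inside ?J \<or> path_image k - {a, b} \<subseteq> outside ?J"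
    using connectedD[OF con J(8) J(9)] J(4) by blast
  then show ?thesis using mo m J(4) by blast
qed

text \<open>Each region is connected and misses the boundary of the other one, so regions that meet
  would coincide, and so would their boundary curves; but \<open>m\<close> lies on only one of
  them.\<close>

lemma insides_disjoint:
  fixes g h k :: "real \<Rightarrow> complex"
  assumes g: "arc g" "pathstart g = a" "pathfinish g = b" 
    and h: "arc h" "pathstart h = a" "pathfinish h = b" 
    and k: "arc k" "pathstart k = a" "pathfinish k = b" 
    and gh: "path_image g \<inter> path_image h = {a, b}"
    and gk: "path_image g \<inter> path_image k = {a, b}"
    and hk: "path_image h \<inter> path_image k = {a, b}"
    and m: "m \<in> path_image g" "m \<noteq> a" "m \<noteq> b" 
    and k_out: "path_image k - {a, b} \<subseteq> outside (path_image g \<union> path_image h)"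
    and g_out: "path_image g - {a, b} \<subseteq> outside (path_image h \<union> path_image k)"
  shows "inside (path_image g \<union> path_image h) \<inter> inside (path_image h \<union> path_image k) = {}"
proof (rule ccontr)
  let ?J = "path_image g \<union> path_image h" and ?K = "path_image h \<union> path_image k"
  assume ne: "inside ?J \<inter> inside ?K \<noteq> {}"
  note J = jordan_union[OF g h gh] and K = jordan_union[OF h k hk]
  have ab: "{a,b} \<subseteq> path_image h" using hk by auto
  have "inside ?J \<inter> ?K = {}" using k_out J(4,5) ab by blast
  then have "inside ?J \<subseteq> inside ?K \<union> outside ?K" using K(5) by auto
  then have 1: "inside ?J \<subseteq> inside ?K" 
    using connectedD[OF J(2) K(8) K(9)] K(4) ne by blast
  have "inside ?K \<inter> ?J = {}" using g_out K(4,5) ab by blast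
  then have "inside ?K \<subseteq> inside ?J \<union> outside ?J" using J(5) by auto
  then have 2: "inside ?K \<subseteq> inside ?J" 
    using connectedD[OF K(2) J(8) J(9)] J(4) ne by blast
  have "?J = ?K" using 1 2 J(6) K(6) by (metis subset_antisym)
  then show False using m gh gk by auto
qed

text \<open>A point \<open>p\<close> inside the closed curve of the second and third arc is outside
  the other two closed curves, and so is a far point \<open>q\<close>. Those two curves intersect in
  the first arc, which is connected, so by Janiszewski's theorem their union does not separate
  \<open>p\<close> from \<open>q\<close>; yet it contains the curve around \<open>p\<close>.\<close>

theorem no_outer_theta:
  fixes g1 g2 g3 :: "real \<Rightarrow> complex"
  assumes g1: "arc g1" "pathstart g1 = a" "pathfinish g1 = b" 
    and g2: "arc g2" "pathstart g2 = a" "pathfinish g2 = b" 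
    and g3: "arc g3" "pathstart g3 = a" "pathfinish g3 = b" 
    and i12: "path_image g1 \<inter> path_image g2 = {a, b}"
    and i13: "path_image g1 \<inter> path_image g3 = {a, b}"
    and i23: "path_image g2 \<inter> path_image g3 = {a, b}"
    and D: "path_image g1 \<union> path_image g2 \<union> path_image g3 \<subseteq> D" "bounded D"
    and m1: "m1 \<in> path_image g1 - {a, b}" "m1 \<in> frontier (outside D)"
    and m2: "m2 \<in> path_image g2 - {a, b}" "m2 \<in> frontier (outside D)"
    and m3: "m3 \<in> path_image g3 - {a, b}" "m3 \<in> frontier (outside D)"
  shows False
proof -
  let ?C1 = "path_image g1" and ?C2 = "path_image g2" and ?C3 = "path_image g3"
  have i21: "?C2 \<inter> ?C1 = {a,b}" and i31: "?C3 \<inter> ?C1 = {a,b}" and i32: "?C3 \<inter> ?C2 = {a,b}"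
    using i12 i13 i23 by auto
  have o3: "?C3 - {a,b} \<subseteq> outside (?C1 \<union> ?C2)"
    by (rule arc_third_outside[OF g1 g2 g3 i12 i13 i23]) (use D m3 in auto)
  have o2: "?C2 - {a,b} \<subseteq> outside (?C1 \<union> ?C3)"
    by (rule arc_third_outside[OF g1 g3 g2 i13 i12 i32]) (use D m2 in auto)
  have o1: "?C1 - {a,b} \<subseteq> outside (?C2 \<union> ?C3)"
    by (rule arc_third_outside[OF g2 g3 g1 i23 i21 i31]) (use D m1 in auto)
  have d1: "inside (?C1 \<union> ?C2) \<inter> inside (?C2 \<union> ?C3) = {}"
    by (rule insides_disjoint[OF g1 g2 g3 i12 i13 i23]) (use m1 o1 o3 in auto)
  have d2: "inside (?C1 \<union> ?C3) \<inter> inside (?C3 \<union> ?C2) = {}"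
    by (rule insides_disjoint[OF g1 g3 g2 i13 i12 i32]) (use m1 o1 o2 in \<open>auto simp: Un_commute\<close>)
  note J12 = jordan_union[OF g1 g2 i12] and J13 = jordan_union[OF g1 g3 i13] 
    and J23 = jordan_union[OF g2 g3 i23]
  obtain p where p: "p \<in> inside (?C2 \<union> ?C3)" using J23(1) by auto
  have cpt: "compact (?C1 \<union> ?C2)" "compact (?C1 \<union> ?C3)"
    using g1 g2 g3 by (auto simp: compact_arc_image)
  have pC: "p \<notin> ?C1" "p \<notin> ?C2" "p \<notin> ?C3"
    using p o1 J23(4,5) i12 by blast+
  have p12: "p \<in> outside (?C1 \<union> ?C2)" using p d1 J12(5) pC by blast
  have p13: "p \<in> outside (?C1 \<union> ?C3)" using p d2 J13(5) pC unfolding Un_commute[of ?C3 ?C2] by blast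
  have "\<not> bounded (outside D)" using D(2) by (simp add: unbounded_outside)
  then obtain q where q: "q \<in> outside D" by fastforce
  have qo: "q \<in> outside (?C1 \<union> ?C2)" "q \<in> outside (?C1 \<union> ?C3)" "q \<in> outside (?C2 \<union> ?C3)"
    using q D(1) outside_mono[of _ D] by blast+
  have "Topological_Spaces.connected ((?C1 \<union> ?C2) \<inter> (?C1 \<union> ?C3))"
  proof -
    have "(?C1 \<union> ?C2) \<inter> (?C1 \<union> ?C3) = ?C1" using i23 i12 by auto
    then show ?thesis using g1 by (simp add: connected_arc_image)
  qed
  moreover have "connected_component (- (?C1 \<union> ?C2)) p q"
    unfolding connected_component_def using J12(3,5) p12 qo(1) by blast
  moreover have "connected_component (- (?C1 \<union> ?C3)) p q"
    unfolding connected_component_def using J13(3,5) p13 qo(2) by blast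
  ultimately have "connected_component (- ((?C1 \<union> ?C2) \<union> (?C1 \<union> ?C3))) p q"
    using Janiszewski[OF cpt(1) compact_imp_closed[OF cpt(2)]] by blast
  then obtain T where T: "Topological_Spaces.connected T" "p \<in> T" "q \<in> T" "T \<subseteq> - (?C2 \<union> ?C3)"
    unfolding connected_component_def by auto
  have "T \<subseteq> inside (?C2 \<union> ?C3) \<union> outside (?C2 \<union> ?C3)" using T(4) J23(5) by auto
  then show False using connectedD[OF T(1) J23(8) J23(9)] J23(4) T p qo(3) by blast
qed

section \<open>Theta subgraphs of outerplanar graphs\<close>

text \<open>A subdivided \<open>K_{2,3}\<close> with branch vertices \<open>x\<close> and
  \<open>y\<close>. Every path has an inner vertex, which supplies the point on the outer face that
  its arc needs.\<close>

definition theta :: "('a \<Rightarrow> 'a \<Rightarrow> bool) \<Rightarrow> bool" where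
  "theta E \<longleftrightarrow> (\<exists>x y P Q R. P \<noteq> [] \<and> Q \<noteq> [] \<and> R \<noteq> [] \<and> distinct (x # y # P @ Q @ R) \<and>
     successively E (x # P @ [y]) \<and> successively E (x # Q @ [y]) \<and> successively E (x # R @ [y]))"

lemma successively_zip:
  assumes "successively E xs" "(a, b) \<in> set (zip xs (tl xs))"
  shows "E a b"
  using assms by (induction xs rule: induct_list012) auto

text \<open>The image is recorded as an exact union of edge curves so that the intersection of two
  such arcs can be examined edge by edge.\<close>

lemma path_arc:
  assumes "planar_drawing G p \<gamma>"
    and "distinct (a # b # zs)" "successively (\<lambda>u v. (u, v) \<in> parcs G) (a # b # zs)"
  shows "\<exists>g. Path_Connected.arc g \<and> pathstart g = p a \<and> pathfinish g = p (last (b # zs)) \<and>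
    path_image g = (\<Union>e\<in>set (zip (a # b # zs) (b # zs)). path_image (\<gamma> e))"
  using assms(2,3)
proof (induction zs arbitrary: a b)
  case Nil
  then have "(a, b) \<in> parcs G" by simp
  then have "Path_Connected.arc (\<gamma> (a, b)) \<and> pathstart (\<gamma> (a, b)) = p a \<and> pathfinish (\<gamma> (a, b)) = p b"
    using assms(1) unfolding planar_drawing_def by fast
  then show ?case by auto
next
  case (Cons c zs)
  then obtain g where g: "Path_Connected.arc g" "pathstart g = p b" "pathfinish g = p (last (c # zs))"
    "path_image g = (\<Union>e\<in>set (zip (b # c # zs) (c # zs)). path_image (\<gamma> e))"
    by (metis distinct.simps(2) successively.simps(3))
  have ab: "(a, b) \<in> parcs G" using Cons.prems by simp
  then have h: "Path_Connected.arc (\<gamma> (a, b))" "pathstart (\<gamma> (a, b)) = p a" "pathfinish (\<gamma> (a, b)) = p b"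
    using assms(1) unfolding planar_drawing_def by fast+
  have "path_image (\<gamma> (a, b)) \<inter> path_image (\<gamma> e) \<subseteq> {p b}" if e: "e \<in> set (zip (b # c # zs) (c # zs))" for e
  proof -
    obtain x y where xy: "e = (x, y)" by fastforce
    have mem: "x \<in> set (b # c # zs)" "y \<in> set (c # zs)" 
      using e set_zip_leftD set_zip_rightD xy by fast+
    then have ne: "{a, b} \<noteq> {x, y}" "{a, b} \<inter> {x, y} \<subseteq> {b}" using Cons.prems(1) by auto
    have "(x, y) \<in> parcs G"
      using successively_zip[of "\<lambda>u v. (u, v) \<in> parcs G" "b # c # zs" x y] e xy Cons.prems(2) by simp
    then have "path_image (\<gamma> (a, b)) \<inter> path_image (\<gamma> (x, y)) \<subseteq> p ` ({a, b} \<inter> {x, y})"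
      using assms(1) ab ne(1) unfolding planar_drawing_def by fast
    then show ?thesis using ne(2) xy by blast
  qed
  then have "path_image (\<gamma> (a, b)) \<inter> path_image g \<subseteq> {pathstart g}" unfolding g by blast
  then have "Path_Connected.arc (\<gamma> (a, b) +++ g)" using h g by (intro arc_join) auto
  moreover have "path_image (\<gamma> (a, b) +++ g) = (\<Union>e\<in>set (zip (a # b # c # zs) (b # c # zs)). path_image (\<gamma> e))"
    using h g by (simp add: path_image_join)
  ultimately show ?case using h g by (intro exI[of _ "\<gamma> (a, b) +++ g"]) simp
qed

text \<open>This makes the edges of internally disjoint paths distinct, so that in a drawing they
  meet only in common ends.\<close>

lemma zip_interior:
  assumes "(a, b) \<in> set (zip (x # P @ [y]) (P @ [y]))" "P \<noteq> []"
  shows "a \<in> set P \<or> b \<in> set P"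
proof -
  obtain c P' where P: "P = c # P'" using assms(2) by (cases P) auto
  have "zip (c # P' @ [y]) (P' @ [y]) = zip (c # P') (P' @ [y])"
    using zip_append1[of "c # P'" "[y]" "P' @ [y]"] by simp
  then show ?thesis using assms(1) P by (auto dest: set_zip_leftD)
qed

lemma outerplanar_no_theta:
  assumes "pair_graph G" "outerplanar G"
  shows "\<not> theta (\<lambda>u v. (u, v) \<in> parcs G)"
proof
  interpret pair_graph G by fact
  let ?E = "\<lambda>u v. (u, v) \<in> parcs G"
  assume "theta ?E"
  then obtain x y P Q R where PQR: "P \<noteq> []" "Q \<noteq> []" "R \<noteq> []" "distinct (x # y # P @ Q @ R)"
     "successively ?E (x # P @ [y])" "successively ?E (x # Q @ [y])" "successively ?E (x # R @ [y])"
    unfolding theta_def by blast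
  obtain p \<gamma> where pl: "planar_drawing G p \<gamma>" and 
    out: "p ` pverts G \<subseteq> frontier (outside (drawing_points G p \<gamma>))"
    using assms(2) unfolding outerplanar_def by blast
  define D where "D = drawing_points G p \<gamma>"
  have inj: "inj_on p (pverts G)" using pl by (auto simp: planar_drawing_def)
  have bD: "bounded D"
  proof -
    have "bounded (path_image (\<gamma> e))" if "e \<in> parcs G" for e
    proof -
      have "Path_Connected.arc (\<gamma> e)" using pl that unfolding planar_drawing_def by (cases e) fast
      then show ?thesis by (simp add: arc_imp_path bounded_path_image)
    qed
    then show ?thesis using pair_finite_verts pair_finite_arcs 
      unfolding D_def drawing_points_def by (simp add: finite_imp_bounded bounded_UN)
  qed
  define I where "I = (\<lambda>zs. \<Union>e\<in>set (zip (x # zs @ [y]) (zs @ [y])). path_image (\<gamma> e))"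
  have arc: "\<exists>g. Path_Connected.arc g \<and> pathstart g = p x \<and> pathfinish g = p y \<and> path_image g = I zs"
    and sub: "I zs \<subseteq> D" and mid: "\<exists>m \<in> I zs - {p x, p y}. m \<in> frontier (outside D)"
    if zs: "zs \<noteq> []" "distinct (x # zs @ [y])" "successively ?E (x # zs @ [y])" for zs
  proof -
    obtain b us where b: "zs @ [y] = b # us" using zs by (cases zs) auto
    show g: "\<exists>g. Path_Connected.arc g \<and> pathstart g = p x \<and> pathfinish g = p y \<and> path_image g = I zs"
      using path_arc[OF pl, of x b us] zs unfolding I_def b by (metis b last_snoc)
    show "I zs \<subseteq> D"
      using successively_zip[OF zs(3)] unfolding I_def D_def drawing_points_def by fastforce
    \<comment> \<open>The first inner vertex serves as the point on the outer face.\<close>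
    obtain c us where c: "zs = c # us" using zs by (cases zs) auto
    have xc: "(x, c) \<in> parcs G" using zs(3) c by simp
    have "pathfinish (\<gamma> (x, c)) = p c" using pl xc unfolding planar_drawing_def by fast
    then have "p c \<in> I zs" unfolding I_def c using pathfinish_in_path_image[of "\<gamma> (x, c)"] by auto
    have "(last zs, y) \<in> parcs G" 
      using zs(1,3) by (metis append_is_Nil_conv list.sel(1) not_Cons_self2 successively_Cons successively_append_iff)
    then have V: "x \<in> pverts G" "c \<in> pverts G" "y \<in> pverts G" using xc wellformed' by blast+
    have "p c \<noteq> p x" "p c \<noteq> p y" using inj V zs(2) c by (auto dest: inj_onD)
    then show "\<exists>m \<in> I zs - {p x, p y}. m \<in> frontier (outside D)"
      using \<open>p c \<in> I zs\<close> V out D_def by auto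
  qed
  have int: "I zs \<inter> I ws \<subseteq> {p x, p y}" 
    if zs: "zs \<noteq> []" "distinct (x # zs @ [y])" "successively ?E (x # zs @ [y])"
    and ws: "ws \<noteq> []" "distinct (x # ws @ [y])" "successively ?E (x # ws @ [y])" 
    and d: "set zs \<inter> set ws = {}" for zs ws
  proof -
    have "path_image (\<gamma> e) \<inter> path_image (\<gamma> f) \<subseteq> {p x, p y}"
      if e: "e \<in> set (zip (x # zs @ [y]) (zs @ [y]))" and f: "f \<in> set (zip (x # ws @ [y]) (ws @ [y]))" for e f
    proof -
      obtain a b c d where abcd: "e = (a, b)" "f = (c, d)" by (cases e, cases f) auto
      have ab': "(a, b) \<in> set (zip (x # zs @ [y]) (zs @ [y]))" 
        and cd': "(c, d) \<in> set (zip (x # ws @ [y]) (ws @ [y]))" using e f abcd by auto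
      have ab: "a \<in> set (x # zs @ [y])" "b \<in> set (zs @ [y])" "a \<in> set zs \<or> b \<in> set zs" "(a, b) \<in> parcs G"
        by (fact set_zip_leftD[OF ab'], fact set_zip_rightD[OF ab'], fact zip_interior[OF ab' zs(1)],
            rule successively_zip[OF zs(3)], simp only: list.sel ab')
      have cd: "c \<in> set (x # ws @ [y])" "d \<in> set (ws @ [y])" "(c, d) \<in> parcs G"
        by (fact set_zip_leftD[OF cd'], fact set_zip_rightD[OF cd'],
            rule successively_zip[OF ws(3)], simp only: list.sel cd')
      have ne: "{a, b} \<noteq> {c, d}" "{a, b} \<inter> {c, d} \<subseteq> {x, y}" using ab cd d zs(2) ws(2) by auto
      have "path_image (\<gamma> (a, b)) \<inter> path_image (\<gamma> (c, d)) \<subseteq> p ` ({a, b} \<inter> {c, d})"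
        using pl ab(4) cd(3) ne(1) unfolding planar_drawing_def by fast
      then show ?thesis using ne(2) abcd by blast
    qed
    then show ?thesis unfolding I_def by blast
  qed
  have P: "distinct (x # P @ [y])" and Q: "distinct (x # Q @ [y])" and R: "distinct (x # R @ [y])"
    using PQR(4) by auto
  have PQ: "set P \<inter> set Q = {}" and PR: "set P \<inter> set R = {}" and QR: "set Q \<inter> set R = {}"
    using PQR(4) by auto
  obtain g1 where g1: "Path_Connected.arc g1" "pathstart g1 = p x" "pathfinish g1 = p y" "path_image g1 = I P"
    using arc[OF PQR(1) P PQR(5)] by blast
  obtain g2 where g2: "Path_Connected.arc g2" "pathstart g2 = p x" "pathfinish g2 = p y" "path_image g2 = I Q"
    using arc[OF PQR(2) Q PQR(6)] by blast
  obtain g3 where g3: "Path_Connected.arc g3" "pathstart g3 = p x" "pathfinish g3 = p y" "path_image g3 = I R"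
    using arc[OF PQR(3) R PQR(7)] by blast
  obtain m1 where m1: "m1 \<in> I P - {p x, p y}" "m1 \<in> frontier (outside D)" using mid[OF PQR(1) P PQR(5)] by blast
  obtain m2 where m2: "m2 \<in> I Q - {p x, p y}" "m2 \<in> frontier (outside D)" using mid[OF PQR(2) Q PQR(6)] by blast
  obtain m3 where m3: "m3 \<in> I R - {p x, p y}" "m3 \<in> frontier (outside D)" using mid[OF PQR(3) R PQR(7)] by blast
  have ends: "{p x, p y} \<subseteq> I P" "{p x, p y} \<subseteq> I Q" "{p x, p y} \<subseteq> I R"
    using pathstart_in_path_image[of g1] pathfinish_in_path_image[of g1] g1
      pathstart_in_path_image[of g2] pathfinish_in_path_image[of g2] g2
      pathstart_in_path_image[of g3] pathfinish_in_path_image[of g3] g3 by simp_all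
  show False
  proof (rule no_outer_theta[OF g1(1-3) g2(1-3) g3(1-3)])
    show "path_image g1 \<inter> path_image g2 = {p x, p y}" unfolding g1(4) g2(4)
      by (rule subset_antisym[OF int[OF PQR(1) P PQR(5) PQR(2) Q PQR(6) PQ] Int_greatest[OF ends(1,2)]])
    show "path_image g1 \<inter> path_image g3 = {p x, p y}" unfolding g1(4) g3(4)
      by (rule subset_antisym[OF int[OF PQR(1) P PQR(5) PQR(3) R PQR(7) PR] Int_greatest[OF ends(1,3)]])
    show "path_image g2 \<inter> path_image g3 = {p x, p y}" unfolding g2(4) g3(4)
      by (rule subset_antisym[OF int[OF PQR(2) Q PQR(6) PQR(3) R PQR(7) QR] Int_greatest[OF ends(2,3)]])
    show "path_image g1 \<union> path_image g2 \<union> path_image g3 \<subseteq> D" unfolding g1(4) g2(4) g3(4)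
      by (intro Un_least sub[OF PQR(1) P PQR(5)] sub[OF PQR(2) Q PQR(6)] sub[OF PQR(3) R PQR(7)])
  qed (unfold g1(4) g2(4) g3(4), rule bD, rule m1(1), rule m1(2), rule m2(1), rule m2(2), rule m3(1), rule m3(2))
qed

section \<open>Hamiltonian cycles with non-crossing chords\<close>

text \<open>Two adjacent vertices count as a degenerate cycle.\<close>

definition is_cycle :: "('a \<Rightarrow> 'a \<Rightarrow> bool) \<Rightarrow> 'a list \<Rightarrow> bool" where
  "is_cycle E xs \<longleftrightarrow> distinct xs \<and> length xs \<ge> 2 \<and> successively E xs \<and> E (last xs) (hd xs)"

lemma thetaI:
  assumes "distinct (x # y # P @ Q @ R)" "P \<noteq> []" "Q \<noteq> []" "R \<noteq> []" 
    "successively E (x # P @ [y])" "successively E (x # Q @ [y])" "successively E (x # R @ [y])"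
  shows "theta E"
  unfolding theta_def using assms by blast

lemma is_cycle_rotate:
  assumes "is_cycle E (xs @ ys)"
  shows "is_cycle E (ys @ xs)"
  using assms unfolding is_cycle_def 
  by (cases "xs = []"; cases "ys = []") (auto simp: successively_append_iff)

lemma successively_rev_sym:
  assumes "\<And>u v. E u v \<Longrightarrow> E v u" "successively E xs"
  shows "successively E (rev xs)"
  using assms by (auto intro: successively_mono)

lemma successively_middle: "successively E (us @ vs @ ws) \<Longrightarrow> successively E vs"
  by (simp add: successively_append_iff)

lemma successively_join:
  "successively E (us @ [y]) \<Longrightarrow> successively E (y # vs) \<Longrightarrow> successively E (us @ y # vs)"
  by (simp add: successively_append_iff)

text \<open>Induction along the walk; when it returns to a vertex of the path, the path is cut back
  to that vertex.\<close>

lemma rtrancl_imp_path: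
  assumes "(v, w) \<in> {(a, b). E a b \<and> a \<in> U \<and> b \<in> U}\<^sup>*" "v \<in> U"
  shows "\<exists>ps. ps \<noteq> [] \<and> distinct ps \<and> set ps \<subseteq> U \<and> hd ps = v \<and> last ps = w \<and> successively E ps"
  using assms
proof (induction rule: rtrancl_induct)
  case base
  then show ?case by (intro exI[of _ "[v]"]) simp
next
  case (step w z)
  then obtain ps where ps: "ps \<noteq> []" "distinct ps" "set ps \<subseteq> U" "hd ps = v" "last ps = w" "successively E ps"
    by blast
  show ?case
  proof (cases "z \<in> set ps")
    case True
    then obtain as bs where ab: "ps = as @ z # bs" by (meson split_list)
    then have "ps = (as @ [z]) @ bs" by simp
    then have "distinct (as @ [z])" "set (as @ [z]) \<subseteq> U" "successively E (as @ [z])"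
      using ps by (auto simp: successively_append_iff)
    moreover have "hd (as @ [z]) = v" using ps(4) ab by (cases as) auto
    ultimately show ?thesis by (intro exI[of _ "as @ [z]"]) simp
  next
    case False
    then have "distinct (ps @ [z])" "set (ps @ [z]) \<subseteq> U" "successively E (ps @ [z])" "hd (ps @ [z]) = v"
      using ps step.hyps(2) by (auto simp: successively_append_iff)
    then show ?thesis by (intro exI[of _ "ps @ [z]"]) simp
  qed
qed

text \<open>The set \<open>S\<close> reachable from \<open>v\<close> outside \<open>C\<close> has an
  edge that leaves it and avoids \<open>x\<close>. Its other end is in \<open>C\<close>, since
  \<open>S\<close> is closed under neighbours outside \<open>C\<close>. The vertex \<open>z\<close>
  makes \<open>S\<close> a proper subset of \<open>V - {x}\<close>.\<close>

lemma cycle_ear: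
  assumes sym: "\<And>u v. E u v \<Longrightarrow> E v u"
    and cut: "\<And>S. S \<noteq> {} \<Longrightarrow> S \<subset> V - {x} \<Longrightarrow> \<exists>a\<in>S. \<exists>b\<in>V - {x} - S. E a b"
    and C: "C \<subseteq> V" "x \<in> C" "z \<in> C" "z \<noteq> x"
    and v: "v \<in> V - C" "E x v"
  shows "\<exists>ps y. ps \<noteq> [] \<and> distinct ps \<and> set ps \<subseteq> V - C \<and> y \<in> C \<and> y \<noteq> x \<and> successively E (x # ps @ [y])"
proof -
  let ?R = "{(a, b). E a b \<and> a \<in> V - C \<and> b \<in> V - C}"
  define S where "S = {w. (v, w) \<in> ?R\<^sup>*}"
  have S: "S \<subseteq> V - C"
  proof
    fix w assume "w \<in> S"
    then have "(v, w) \<in> ?R\<^sup>*" by (simp add: S_def)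
    then show "w \<in> V - C" using v(1) by (induction rule: rtrancl_induct) auto
  qed
  have "v \<in> S" by (simp add: S_def)
  moreover have "S \<subset> V - {x}" using S C by auto
  ultimately obtain w y where wy: "w \<in> S" "y \<in> V - {x} - S" "E w y" using cut[of S] by blast
  have "y \<in> C"
  proof (rule ccontr)
    assume "y \<notin> C"
    then have "(w, y) \<in> ?R" using wy S by auto
    then have "y \<in> S" using wy(1) unfolding S_def by (auto intro: rtrancl_into_rtrancl)
    then show False using wy(2) by simp
  qed
  have "(v, w) \<in> ?R\<^sup>*" using wy(1) by (simp add: S_def)
  then obtain ps where ps: "ps \<noteq> []" "distinct ps" "set ps \<subseteq> V - C" "hd ps = v" "last ps = w" "successively E ps"
    using rtrancl_imp_path[of v w E "V - C"] v(1) by auto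
  then have "successively E (x # ps @ [y])" using v(2) wy(3) by (auto simp: successively_append_iff successively_Cons)
  then show ?thesis using ps \<open>y \<in> C\<close> wy(2) by blast
qed

text \<open>A vertex missed by a longest cycle yields an ear between two vertices \<open>x\<close>
  and \<open>y\<close> of the cycle. If both cycle paths between them have inner vertices, they form
  a theta with the ear; otherwise the ear replaces the edge between \<open>x\<close> and
  \<open>y\<close> in a longer cycle. Degenerate cycles let the search start from a single
  edge.\<close>

lemma hamiltonian_cycle:
  fixes E :: "'a \<Rightarrow> 'a \<Rightarrow> bool"
  assumes fin: "finite V" and EV: "\<And>u v. E u v \<Longrightarrow> u \<in> V \<and> v \<in> V \<and> u \<noteq> v"
    and sym: "\<And>u v. E u v \<Longrightarrow> E v u"
    and cut: "\<And>S X. X = {} \<or> (\<exists>x\<in>V. X = {x}) \<Longrightarrow> S \<noteq> {} \<Longrightarrow> S \<subset> V - X \<Longrightarrow> \<exists>a\<in>S. \<exists>b\<in>V - X - S. E a b"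
    and card: "card V \<ge> 2" and th: "\<not> theta E"
  shows "\<exists>xs. is_cycle E xs \<and> set xs = V"
proof -
  obtain a where a: "a \<in> V" using card by fastforce
  have "V \<noteq> {a}" using card by auto
  then have "{a} \<subset> V" using a by auto
  then obtain b where "E a b" using cut[of "{}" "{a}"] by auto
  then have init: "is_cycle E [a, b]" using EV sym unfolding is_cycle_def by auto
  have in_V: "set xs \<subseteq> V" if "is_cycle E xs" for xs
  proof
    fix x assume "x \<in> set xs"
    then obtain as bs where ab: "xs = as @ x # bs" by (meson split_list)
    have "is_cycle E (x # bs @ as)" using is_cycle_rotate[of E as "x # bs"] that ab by simp
    then show "x \<in> V" unfolding is_cycle_def using EV by (cases "bs @ as") auto
  qed
  have bound: "length xs < Suc (card V)" if "is_cycle E xs" for xs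
    using card_mono[OF fin in_V[OF that]] that by (simp add: is_cycle_def distinct_card)
  obtain xs where xs: "is_cycle E xs" and max: "\<And>ys. is_cycle E ys \<Longrightarrow> length ys \<le> length xs"
    using ex_has_greatest_nat[of "is_cycle E" "[a, b]" length "Suc (card V)"] init bound by blast
  have sub: "set xs \<subseteq> V" by (rule in_V[OF xs])
  have "set xs = V"
  proof (rule ccontr)
    assume "set xs \<noteq> V"
    then have "set xs \<subset> V" using sub by auto
    moreover have "set xs \<noteq> {}" using xs unfolding is_cycle_def by auto
    ultimately obtain x v where xv: "x \<in> set xs" "v \<in> V - set xs" "E x v" using cut[of "{}" "set xs"] by auto
    obtain as bs where ab: "xs = as @ x # bs" using xv(1) by (meson split_list)
    define zs where "zs = bs @ as"
    have cyc: "is_cycle E (x # zs)" using is_cycle_rotate[of E as "x # bs"] xs ab zs_def by simp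
    have set_zs: "set xs = insert x (set zs)" "length xs = Suc (length zs)" using ab zs_def by auto
    obtain z where z: "z \<in> set zs" "z \<noteq> x" using cyc unfolding is_cycle_def by (cases zs) auto
    have zx: "z \<in> set xs" using z(1) set_zs(1) by blast
    have "\<exists>ps y. ps \<noteq> [] \<and> distinct ps \<and> set ps \<subseteq> V - set xs \<and> y \<in> set xs \<and> y \<noteq> x \<and>
      successively E (x # ps @ [y])"
    proof (rule cycle_ear[where E = E, OF sym _ sub xv(1) zx z(2) xv(2,3)])
      show "\<exists>a\<in>S. \<exists>b\<in>V - {x} - S. E a b" if "S \<noteq> {}" "S \<subset> V - {x}" for S
        using cut[of "{x}" S] that sub xv(1) by blast
    qed
    then obtain ps y where ps: "ps \<noteq> []" "distinct ps" "set ps \<subseteq> V - set xs" "y \<in> set xs" "y \<noteq> x" 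
      "successively E (x # ps @ [y])" by blast
    have "y \<in> set zs" using ps(4,5) set_zs by auto
    then obtain P Q where PQ: "zs = P @ y # Q" by (meson split_list)
    have dist: "distinct (x # y # P @ rev Q @ ps)" using cyc PQ ps(2,3) set_zs unfolding is_cycle_def by auto
    have sP: "successively E (x # P @ [y])" 
      by (rule successively_middle[of E "[]" _ Q]) (use cyc PQ in \<open>simp add: is_cycle_def\<close>)
    have sQ1: "successively E (y # Q)" 
      by (rule successively_middle[of E "x # P" _ "[]"]) (use cyc PQ in \<open>simp add: is_cycle_def\<close>)
    have "E (last (y # Q)) x" using cyc PQ unfolding is_cycle_def by simp
    then have sQ0: "successively E (y # Q @ [x])" 
      using sQ1 successively_append_iff[of E "y # Q" "[x]"] by simp
    have sQ: "successively E (x # rev Q @ [y])" using successively_rev_sym[OF sym sQ0] by simp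
    have sr: "successively E (y # rev ps @ [x])" using successively_rev_sym[OF sym ps(6)] by simp
    consider "P = []" | "Q = []" | "P \<noteq> []" "Q \<noteq> []" by blast
    then show False
    proof cases
      case 1
      have "is_cycle E (x # ps @ y # Q)"
      proof -
        have "successively E (x # ps @ y # Q)"
          using successively_join[of E "x # ps" y Q] ps(6) sQ1 by simp
        moreover have "E (last (y # Q)) x" using sQ0 successively_append_iff[of E "y # Q" "[x]"] by simp
        ultimately show ?thesis using dist 1 unfolding is_cycle_def by auto
      qed
      then show False using max[of "x # ps @ y # Q"] set_zs(2) PQ 1 ps(1) by (cases ps) auto
    next
      case 2
      have "is_cycle E (x # P @ y # rev ps)"
      proof -
        have "successively E ((y # rev ps) @ [x])" using sr by simp
        then have y: "successively E (y # rev ps)" "E (last (y # rev ps)) x" 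
          unfolding successively_append_iff by simp_all
        moreover have "successively E (x # P @ y # rev ps)"
          using successively_join[of E "x # P" y "rev ps"] sP y(1) by simp
        ultimately show ?thesis using dist 2 unfolding is_cycle_def by auto
      qed
      then show False using max[of "x # P @ y # rev ps"] set_zs(2) PQ 2 ps(1) by (cases ps) auto
    next
      case 3
      then have "theta E" by (intro thetaI[OF dist _ _ ps(1) sP sQ ps(6)]) simp_all
      then show False using th by simp
    qed
  qed
  then show ?thesis using xs by blast
qed

section \<open>Crossing chords\<close>

text \<open>The paths from \<open>p\<close> to \<open>q\<close> run through \<open>A\<close>, along
  the first chord to \<open>r\<close> and back through \<open>B\<close>, and back through
  \<open>D\<close> to \<open>s\<close> and along the second chord. The last two contain
  \<open>r\<close> and \<open>s\<close>, so only \<open>A\<close> could lack an inner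
  vertex.\<close>

lemma crossing_theta:
  assumes sym: "\<And>u v. E u v \<Longrightarrow> E v u"
    and cyc: "is_cycle E (p # A @ q # B @ r # C @ s # D)" and A: "A \<noteq> []"
    and ch: "E p r" "E q s"
  shows "theta E"
proof -
  have d: "distinct (p # q # A @ (r # rev B) @ (rev D @ [s]))" using cyc unfolding is_cycle_def by auto
  have suc: "successively E (p # A @ q # B @ r # C @ s # D)" using cyc by (simp add: is_cycle_def)
  have 1: "successively E (p # A @ [q])"
    by (rule successively_middle[of E "[]" _ "B @ r # C @ s # D"]) (use suc in simp)
  have "successively E (q # B @ [r])"
    by (rule successively_middle[of E "p # A" _ "C @ s # D"]) (use suc in simp)
  from successively_rev_sym[OF sym this] ch(1) have 2: "successively E (p # (r # rev B) @ [q])" by simp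
  have "successively E (s # D)"
    by (rule successively_middle[of E "p # A @ q # B @ r # C" _ "[]"]) (use suc in simp)
  moreover have "E (last (s # D)) p" using cyc by (simp add: is_cycle_def)
  ultimately have "successively E (q # s # D @ [p])"
    using ch(2) successively_append_iff[of E "s # D" "[p]"] by simp
  from successively_rev_sym[OF sym this] have 3: "successively E (p # (rev D @ [s]) @ [q])" by simp
  show ?thesis by (rule thetaI[OF d A _ _ 1 2 3]) simp_all
qed

text \<open>Crossing chords avoid a theta only if their successive ends are neighbours on the cycle,
  as in \<open>K_4\<close>. Then \<open>p\<close>, \<open>q\<close>, \<open>r\<close> form a
  triangle, against bipartiteness.\<close>

lemma no_crossing:
  assumes sym: "\<And>u v. E u v \<Longrightarrow> E v u" and th: "\<not> theta E" and bip: "\<And>u v. E u v \<Longrightarrow> side u \<noteq> (side v :: bool)"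
    and cyc: "is_cycle E (Z @ p # A @ q # B @ r # C @ s # D)" 
    and ch: "E p r" "E q s"
  shows False
proof -
  have c1: "is_cycle E (p # A @ q # B @ r # C @ s # (D @ Z))"
    using is_cycle_rotate[OF cyc] by simp
  have c2: "is_cycle E (q # B @ r # C @ s # (D @ Z) @ p # A)"
    using is_cycle_rotate[of E "p # A" "q # B @ r # C @ s # (D @ Z)"] c1 by simp
  have "A = []" using crossing_theta[OF sym c1 _ ch] th by blast
  moreover have "B = []" using crossing_theta[OF sym c2 _ ch(2) sym[OF ch(1)]] th by blast
  ultimately have "E p q" "E q r" using c1 unfolding is_cycle_def by (auto simp: successively_Cons)
  then show False using bip ch(1) by metis
qed

lemma no_crossing_nth:
  assumes sym: "\<And>u v. E u v \<Longrightarrow> E v u" and th: "\<not> theta E" and bip: "\<And>u v. E u v \<Longrightarrow> side u \<noteq> (side v :: bool)"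
    and cyc: "is_cycle E xs" and ijkl: "i < k" "k < j" "j < l" "l < length xs"
    and ch: "E (xs ! i) (xs ! j)" "E (xs ! k) (xs ! l)"
  shows False
proof -
  have split: "take m xs @ drop m xs = xs" "drop m xs = xs ! m # drop (Suc m) xs" if "m < length xs" for m
    using that by (auto simp: Cons_nth_drop_Suc)
  define A B C D Z where "A = take (k - Suc i) (drop (Suc i) xs)" and "B = take (j - Suc k) (drop (Suc k) xs)"
    and "C = take (l - Suc j) (drop (Suc j) xs)" and "D = drop (Suc l) xs" and "Z = take i xs"
  have step: "drop (Suc m) xs = take (n - Suc m) (drop (Suc m) xs) @ xs ! n # drop (Suc n) xs" 
    if "m < n" "n < length xs" for m n
  proof -
    have "drop (n - Suc m) (drop (Suc m) xs) = xs ! n # drop (Suc n) xs" using that by (simp add: Cons_nth_drop_Suc)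
    then show ?thesis by (metis append_take_drop_id)
  qed
  have 1: "xs = Z @ xs ! i # drop (Suc i) xs" using split[of i] ijkl Z_def by simp
  have 2: "drop (Suc i) xs = A @ xs ! k # drop (Suc k) xs" unfolding A_def by (rule step) (use ijkl in auto)
  have 3: "drop (Suc k) xs = B @ xs ! j # drop (Suc j) xs" unfolding B_def by (rule step) (use ijkl in auto)
  have 4: "drop (Suc j) xs = C @ xs ! l # D" unfolding C_def D_def by (rule step) (use ijkl in auto)
  have "xs = Z @ xs ! i # A @ xs ! k # B @ xs ! j # C @ xs ! l # D" by (rule 1[unfolded 2 3 4])
  then have "is_cycle E (Z @ xs ! i # A @ xs ! k # B @ xs ! j # C @ xs ! l # D)" using cyc by argo
  from no_crossing[where E = E and side = side, OF sym th bip this ch] show False .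
qed

section \<open>Labels along an attached path\<close>

text \<open>
  A path is attached to the edge \<open>a\<^sub>0b\<^sub>0\<close> so that the new face is \<open>b\<^sub>0, a\<^sub>0, b\<^sub>1, a\<^sub>1, \<dots>, b\<^sub>k\<^sub>-\<^sub>1, a\<^sub>k\<^sub>-\<^sub>1, b\<^sub>k = b\<^sub>0\<close>.
  \<open>K\<close> and \<open>S\<close> are the classes and signs of the \<open>b\<^sub>j\<close>, and \<open>L\<close> the labels of the \<open>a\<^sub>j\<close>. Here
  \<open>kv\<close>, \<open>\<sigma>\<close> belong to \<open>b\<^sub>0\<close> and \<open>e\<close> to \<open>a\<^sub>0\<close>; \<open>k2\<close>, \<open>\<sigma>2\<close> belong to the other neighbour of \<open>a\<^sub>0\<close>, and \<open>p\<close> is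
  the label of the other neighbour of \<open>b\<^sub>0\<close>.
\<close>

definition ear_ok :: "nat \<Rightarrow> nat \<Rightarrow> nat \<Rightarrow> nat \<Rightarrow> nat \<Rightarrow> bool \<Rightarrow> bool \<Rightarrow> (nat \<Rightarrow> nat) \<Rightarrow> (nat \<Rightarrow> nat) \<Rightarrow> (nat \<Rightarrow> bool) \<Rightarrow> bool" where
  "ear_ok k kv k2 e p \<sigma> \<sigma>2 K L S \<longleftrightarrow>
     K 0 = kv \<and> K k = kv \<and> L 0 = e \<and> S 0 = \<sigma> \<and> S k = \<sigma> \<and> K 1 \<noteq> k2 \<and>
     (\<forall>j<k. K j < 3 \<and> L j < 3 \<and> K j \<noteq> K (Suc j)) \<and>
     (\<forall>j. Suc j < k \<longrightarrow> K (Suc j) = 2 \<longrightarrow> L (Suc j) = L j) \<and>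
     (\<forall>j. Suc j < k \<longrightarrow> K (Suc j) \<noteq> 2 \<longrightarrow> L (Suc j) \<noteq> L j \<or> (k = 2 \<and> kv = 2)) \<and>
     (kv = 2 \<longrightarrow> L (k - 1) = e) \<and>
     (kv \<noteq> 2 \<longrightarrow> L (k - 1) \<noteq> p \<and> (L (k - 1) \<noteq> e \<or> (k = 2 \<and> K 1 = 2))) \<and>
     (\<forall>j<k. L j = 2 \<longrightarrow> S j = S (Suc j)) \<and>
     (\<forall>j<k. L j \<noteq> 2 \<longrightarrow> K j \<noteq> 2 \<longrightarrow> K (Suc j) \<noteq> 2 \<longrightarrow> 
        S j \<noteq> S (Suc j) \<or> (k \<le> 3 \<and> (\<forall>i<k. i \<noteq> j \<longrightarrow> L i = 2))) \<and>
     (e \<noteq> 2 \<longrightarrow> kv = 2 \<longrightarrow> S 1 \<noteq> \<sigma>2)"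

section \<open>Sequences of labels and signs with prescribed ends\<close>

lemma all_less_2: "(\<forall>j<2. P j) \<longleftrightarrow> P 0 \<and> P (Suc 0)" "(\<forall>j. Suc j < 2 \<longrightarrow> P j) \<longleftrightarrow> P 0"
  and all_less_3: "(\<forall>j<3. P j) \<longleftrightarrow> P 0 \<and> P (Suc 0) \<and> P 2" "(\<forall>j. Suc j < 3 \<longrightarrow> P j) \<longleftrightarrow> P 0 \<and> P (Suc 0)"
  for P :: "nat \<Rightarrow> bool"
  by (auto simp: less_Suc_eq numeral_2_eq_2 numeral_3_eq_3)

lemma third_label:
  obtains m :: nat where "m < 3" "m \<noteq> p" "m \<noteq> q"
proof -
  have "card {p, q} \<le> 2" by (simp add: card_insert_if)
  then have "\<not> {..<3} \<subseteq> {p, q}" using card_mono[of "{p, q}" "{..<3::nat}"] by auto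
  then show ?thesis using that by blast
qed

text \<open>The first step goes to a label different from both ends; the rest then has distinct
  ends, for which length 1 is enough.\<close>

lemma label_walk:
  fixes p q n :: nat
  assumes "p < 3" "q < 3" "n \<ge> 1" "p \<noteq> q \<or> n \<ge> 2"
  shows "\<exists>L. L 0 = p \<and> L n = q \<and> (\<forall>j. L j < 3) \<and> (\<forall>j<n. L (Suc j) \<noteq> L j)"
  using assms
proof (induction n arbitrary: p)
  case (Suc n)
  show ?case
  proof (cases "n = 0")
    case True
    then show ?thesis using Suc.prems by (intro exI[of _ "case_nat p (\<lambda>_. q)"]) (auto split: nat.splits)
  next
    case False
    obtain m :: nat where m: "m < 3" "m \<noteq> p" "m \<noteq> q" by (rule third_label)
    then obtain L where "L 0 = m \<and> L n = q \<and> (\<forall>j. L j < 3) \<and> (\<forall>j<n. L (Suc j) \<noteq> L j)"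
      using Suc.IH[of m] Suc.prems False by auto
    then show ?thesis using m Suc.prems 
      by (intro exI[of _ "case_nat p L"]) (auto split: nat.splits simp: less_Suc_eq_0_disj)
  qed
qed simp

text \<open>
  The sign flips at every label other than 2; the walk makes it return to its initial value.
\<close>

lemma even_label_walk:
  fixes q n :: nat
  assumes "q < 2" "n \<ge> 2"
  shows "\<exists>L S. L 0 = 2 \<and> L n = q \<and> (\<forall>j. L j < 3) \<and> (\<forall>j<n. L (Suc j) \<noteq> L j) \<and>
    S 0 = \<sigma> \<and> S n = \<sigma> \<and> (\<forall>j<n. S (Suc j) = (S j \<noteq> (L (Suc j) \<noteq> 2)))"
  using assms(2)
proof (induction n rule: less_induct)
  case (less n)
  \<comment> \<open>The walks \<open>2, 1 - q, q\<close> and \<open>2, q, 2, q\<close> have two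
    labels other than 2 after the start, and appending \<open>1 - q, q\<close> adds two more, so the
    number of flips stays even.\<close>
  consider "n = 2" | "n = 3" | m where "n = Suc (Suc m)" "m \<ge> 2" using less.prems
    by (metis add_2_eq_Suc' le_Suc_eq le_add_diff_inverse2 numeral_2_eq_2 numeral_3_eq_3 Suc_le_mono)
  then show ?case
  proof cases
    case 1
    then show ?thesis using assms(1)
      by (intro exI[of _ "\<lambda>j. if j = 0 then 2 else if j = 1 then 1 - q else q"] 
          exI[of _ "\<lambda>j. if j = 1 then \<not> \<sigma> else \<sigma>"]) (auto simp: less_Suc_eq numeral_2_eq_2)
  next
    case 2
    then show ?thesis using assms(1)
      by (intro exI[of _ "\<lambda>j. if even j then 2 else q"] 
          exI[of _ "\<lambda>j. if j = 1 \<or> j = 2 then \<not> \<sigma> else \<sigma>"]) (auto simp: less_Suc_eq numeral_3_eq_3)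
  next
    case 3
    have q: "Suc 0 - q \<noteq> q" using assms(1) by arith
    from 3 obtain L S where LS: "L 0 = 2" "L m = q" "\<forall>j. L j < 3" "\<forall>j<m. L (Suc j) \<noteq> L j"
      "S 0 = \<sigma>" "S m = \<sigma>" "\<forall>j<m. S (Suc j) = (S j \<noteq> (L (Suc j) \<noteq> 2))" using less.IH[of m] by auto
    show ?thesis using assms(1) q 3 LS
      by (intro exI[of _ "\<lambda>j. if j \<le> m then L j else if j = Suc m then 1 - q else q"] 
          exI[of _ "\<lambda>j. if j \<le> m then S j else if j = Suc m then \<not> \<sigma> else \<sigma>"]) 
        (auto simp: less_Suc_eq)
  qed
qed

text \<open>For fixing the sign at the end of a path when a class-2 vertex near its start leaves the
  sign there free.\<close>

lemma backward_signs:
  "\<exists>T. T k = \<sigma> \<and> (\<forall>j<k. T j = (T (Suc j) \<noteq> f j))"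
proof (induction k arbitrary: f)
  case (Suc k)
  obtain T where T: "T k = \<sigma> \<and> (\<forall>j<k. T j = (T (Suc j) \<noteq> f (Suc j)))" using Suc.IH[of "\<lambda>j. f (Suc j)"] by blast
  then show ?case by (intro exI[of _ "case_nat (T 0 \<noteq> f 0) T"]) (auto split: nat.splits)
qed (intro exI[of _ "\<lambda>_. \<sigma>"], simp)

lemma forward_signs:
  "\<exists>T. T 0 = \<sigma> \<and> (\<forall>j. T (Suc j) = (T j \<noteq> f j))"
  by (intro exI[of _ "rec_nat \<sigma> (\<lambda>j t. t \<noteq> f j)"]) simp


text \<open>
  The class-2 vertex seen by \<open>a\<^sub>0\<close> is forced to be \<open>b\<^sub>1\<close> in the first of the following three cases; it
  is \<open>b\<^sub>0\<close> in the second one, and the other neighbour of \<open>a\<^sub>0\<close> in the third one. In the third case a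
  face with odd \<open>k\<close> needs one more vertex of class 2, and \<open>b\<^sub>2\<close> is used; for \<open>k \<ge> 5\<close> it gets a label
  other than 2, which removes the parity condition on the signs.
\<close>

lemma ear_labels_next:
  assumes k: "k \<ge> 2" and lt: "kv < 2" "k2 < 2" "kv \<noteq> k2" "e < 3" "p < 3" and p: "p \<noteq> e"
  shows "\<exists>K L S. ear_ok k kv k2 e p \<sigma> \<sigma>2 K L S"
proof -
  \<comment> \<open>Only class 2 is left for \<open>b\<^sub>1\<close>. Taking the parity of
    \<open>k - j\<close> makes the other classes alternate and end in \<open>kv\<close>.\<close>
  define K where "K = (\<lambda>j. if j = 1 then 2 else if j = 0 then kv else if even (k - j) then kv else k2)"
  have K: "K 0 = kv" "K k = kv" "K 1 = 2" "\<And>j. K j < 3" "\<And>j. j < k \<Longrightarrow> K j \<noteq> K (Suc j)"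
    using k lt by (auto simp: K_def)
  have K2: "K j \<noteq> 2" if "j \<noteq> 1" for j using lt that by (simp add: K_def)
  \<comment> \<open>The last label of the face has to avoid \<open>p\<close> and, except in a
    4-cycle with \<open>b\<^sub>1\<close> in class 2, also \<open>e\<close>.\<close>
  obtain t :: nat where t: "t < 3" "t \<noteq> e" "t \<noteq> p" by (rule third_label)
  consider "k = 2" | "k = 3" "e = 2" | "k \<ge> 3" "e \<noteq> 2" | "k \<ge> 4" "e = 2" using k by linarith
  then show ?thesis
  proof cases
    case 1
    have "ear_ok k kv k2 e p \<sigma> \<sigma>2 K (\<lambda>_. e) (\<lambda>_. \<sigma>)"
      unfolding ear_ok_def
      by (intro conjI allI impI) (use 1 K K2 lt p in \<open>auto simp: less_Suc_eq numeral_2_eq_2 numeral_3_eq_3\<close>)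
    then show ?thesis by blast
  next
    case 2
    \<comment> \<open>The labels \<open>2, 2, t\<close> force all signs to agree; the vertex
      labelled \<open>t\<close> is excused, as the other two labels are 2.\<close>
    have "ear_ok k kv k2 e p \<sigma> \<sigma>2 K (\<lambda>j. if j \<le> 1 then 2 else t) (\<lambda>_. \<sigma>)"
      unfolding ear_ok_def
      by (intro conjI allI impI) (use 2 K K2 lt p t in \<open>auto simp: less_Suc_eq numeral_2_eq_2 numeral_3_eq_3\<close>)
    then show ?thesis by blast
  next
    case 3
    then obtain L where L: "L 0 = e" "L (k - 2) = t" "\<And>j. L j < 3" "\<And>j. j < k - 2 \<Longrightarrow> L (Suc j) \<noteq> L j"
      using label_walk[of e t "k - 2"] lt t by force
    \<comment> \<open>Both neighbours of \<open>b\<^sub>1\<close> in the face have the label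
      \<open>e\<close>, which is not 2, so its sign is unconstrained from the side of
      \<open>b\<^sub>0\<close> and the signs can be computed backwards from
      \<open>b\<^sub>k\<close>.\<close>
    obtain T where T: "T k = \<sigma>" "\<And>j. j < k \<Longrightarrow> T j = (T (Suc j) \<noteq> (L (j - 1) \<noteq> 2))" 
      using backward_signs[of k \<sigma> "\<lambda>j. L (j - 1) \<noteq> 2"] by blast
    have "ear_ok k kv k2 e p \<sigma> \<sigma>2 K (\<lambda>j. L (j - 1)) (\<lambda>j. if j = 0 then \<sigma> else T j)"
      unfolding ear_ok_def
    proof (intro conjI allI impI)
      fix j assume "Suc j < k" "K (Suc j) = 2"
      then have "j = 0" using K2[of "Suc j"] by auto
      then show "L (Suc j - 1) = L (j - 1)" by simp
    next
      fix j assume "Suc j < k" "K (Suc j) \<noteq> 2"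
      then have "L (Suc (j - 1)) \<noteq> L (j - 1)" "j > 0" using L(4)[of "j - 1"] K(3) by (cases j; auto)+
      then show "L (Suc j - 1) \<noteq> L (j - 1) \<or> k = 2 \<and> kv = 2" by simp
    next
      fix j assume j: "j < k" "L (j - 1) = 2"
      then have "j \<noteq> 0" using L(1) 3 by (intro notI) simp
      then show "(if j = 0 then \<sigma> else T j) = (if Suc j = 0 then \<sigma> else T (Suc j))" using T(2)[of j] j by simp
    next
      fix j assume j: "j < k" "L (j - 1) \<noteq> 2" "K (Suc j) \<noteq> 2"
      then have "j \<noteq> 0" using K(3) by (intro notI) simp
      then show "(if j = 0 then \<sigma> else T j) \<noteq> (if Suc j = 0 then \<sigma> else T (Suc j)) \<or> 
        k \<le> 3 \<and> (\<forall>i<k. i \<noteq> j \<longrightarrow> L (i - 1) = 2)" using T(2)[of j] j by simp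
    qed (use 3 K K2 L T(1) lt t in \<open>auto simp: numeral_2_eq_2\<close>)
    then show ?thesis by blast
  next
    case 4
    then have n: "t < (2::nat)" "2 \<le> k - 2" using lt t by auto
    from even_label_walk[OF n, of \<sigma>] obtain L S where LS: 
      "L 0 = 2 \<and> L (k - 2) = t \<and> (\<forall>j. L j < 3) \<and> (\<forall>j<k - 2. L (Suc j) \<noteq> L j) \<and>
        S 0 = \<sigma> \<and> S (k - 2) = \<sigma> \<and> (\<forall>j<k - 2. S (Suc j) = (S j \<noteq> (L (Suc j) \<noteq> 2)))" by (elim exE)
    have L: "L 0 = 2" "L (k - 2) = t" "\<And>j. L j < 3" "\<And>j. j < k - 2 \<Longrightarrow> L (Suc j) \<noteq> L j"
      "S 0 = \<sigma>" "S (k - 2) = \<sigma>" "\<And>j. j < k - 2 \<Longrightarrow> S (Suc j) = (S j \<noteq> (L (Suc j) \<noteq> 2))"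
      using LS by simp_all
    have S: "S (Suc j - 2) = (S (j - 2) \<noteq> (L (j - 1) \<noteq> 2))" if "2 \<le> j" "j < k" for j
    proof -
      have e: "Suc j - 2 = Suc (j - 2)" "j - 1 = Suc (j - 2)" "j - 2 < k - 2" using that by linarith+
      show ?thesis unfolding e(1,2) by (rule L(7)[OF e(3)])
    qed
    \<comment> \<open>Truncated subtraction repeats the label 2 at \<open>a\<^sub>0\<close>,
      \<open>a\<^sub>1\<close> and the sign at \<open>b\<^sub>0\<close>, \<open>b\<^sub>1\<close>,
      \<open>b\<^sub>2\<close>; the other \<open>k - 2\<close> steps follow the walk with evenly
      many flips.\<close>
    have "ear_ok k kv k2 e p \<sigma> \<sigma>2 K (\<lambda>j. L (j - 1)) (\<lambda>j. S (j - 2))"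
      unfolding ear_ok_def
    proof (intro conjI allI impI)
      fix j assume "Suc j < k" "K (Suc j) = 2"
      then have "j = 0" using K2[of "Suc j"] by auto
      then show "L (Suc j - 1) = L (j - 1)" by simp
    next
      fix j assume "Suc j < k" "K (Suc j) \<noteq> 2"
      then have "L (Suc (j - 1)) \<noteq> L (j - 1)" "j > 0" using L(4)[of "j - 1"] K(3) by (cases j; auto)+
      then show "L (Suc j - 1) \<noteq> L (j - 1) \<or> k = 2 \<and> kv = 2" by simp
    next
      fix j assume j: "j < k" "L (j - 1) = 2"
      show "S (j - 2) = S (Suc j - 2)"
      proof (cases "2 \<le> j")
        case True
        then show ?thesis using S[of j] j by simp
      next
        case False
        then have "j = 0 \<or> j = 1" by auto
        then show ?thesis by auto
      qed
    next
      fix j assume j: "j < k" "L (j - 1) \<noteq> 2" "K j \<noteq> 2" "K (Suc j) \<noteq> 2"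
      then have "j \<noteq> 1" "j \<noteq> 0" using K(3) by (intro notI; simp)+
      then have "2 \<le> j" by simp
      then show "S (j - 2) \<noteq> S (Suc j - 2) \<or> k \<le> 3 \<and> (\<forall>i<k. i \<noteq> j \<longrightarrow> L (i - 1) = 2)"
        using S[of j] j by simp
    qed (use 4 K K2 L(1-6) lt t in \<open>auto simp: numeral_2_eq_2\<close>)
    then show ?thesis by blast
  qed
qed

text \<open>Both neighbours of \<open>b\<^sub>0\<close> in the face get the label \<open>e\<close>.
  If \<open>e\<close> is not 2, they do not tie the sign of \<open>b\<^sub>0\<close> to the others,
  which start at \<open>b\<^sub>1\<close> opposite to \<open>\<sigma>2\<close>; if \<open>e\<close>
  is 2, the signs have to return to \<open>\<sigma>\<close>.\<close>

lemma ear_labels_here: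
  assumes k: "k \<ge> 2" and lt: "k2 < 2" "e < 3"
  shows "\<exists>K L S. ear_ok k 2 k2 e p \<sigma> \<sigma>2 K L S"
proof -
  define K where "K = (\<lambda>j. if j = 0 \<or> j = k then 2 else if odd j then 1 - k2 else k2)"
  have K: "K 0 = 2" "K k = 2" "K 1 \<noteq> k2" "\<And>j. K j < 3" "\<And>j. j < k \<Longrightarrow> K j \<noteq> K (Suc j)"
  proof -
    have "1 - k2 \<noteq> k2" "1 - k2 \<noteq> 2" "k2 \<noteq> 2" using lt by arith+
    then show "K 0 = 2" "K k = 2" "K 1 \<noteq> k2" "\<And>j. K j < 3" "\<And>j. j < k \<Longrightarrow> K j \<noteq> K (Suc j)"
      using k lt by (auto simp: K_def)
  qed
  have K2: "K j \<noteq> 2" if "j \<noteq> 0" "j \<noteq> k" for j using lt that by (auto simp: K_def)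
  consider "k = 2" | "k = 3" "e = 2" | "k \<ge> 3" "e \<noteq> 2" | "k \<ge> 4" "e = 2" using k by linarith
  then show ?thesis
  proof cases
    case 1
    have "ear_ok k 2 k2 e p \<sigma> \<sigma>2 K (\<lambda>_. e) (\<lambda>j. if j = 1 \<and> e \<noteq> 2 then \<not> \<sigma>2 else \<sigma>)"
      unfolding ear_ok_def
      by (intro conjI allI impI) (use 1 K K2 lt in \<open>auto simp: less_Suc_eq numeral_2_eq_2 numeral_3_eq_3\<close>)
    then show ?thesis by blast
  next
    case 2
    \<comment> \<open>With the labels \<open>2, 0, 2\<close> the middle vertex is excused from
      flipping the sign.\<close>
    have "ear_ok k 2 k2 e p \<sigma> \<sigma>2 K (\<lambda>j. if j = 1 then 0 else 2) (\<lambda>_. \<sigma>)"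
      unfolding ear_ok_def
      by (intro conjI allI impI) (use 2 K K2 lt in \<open>auto simp: less_Suc_eq numeral_2_eq_2 numeral_3_eq_3\<close>)
    then show ?thesis by blast
  next
    case 3
    then obtain L where L: "L 0 = e" "L (k - 1) = e" "\<And>j. L j < 3" "\<And>j. j < k - 1 \<Longrightarrow> L (Suc j) \<noteq> L j"
      using label_walk[of e e "k - 1"] lt by force
    obtain T where T: "T 0 = (\<not> \<sigma>2)" "\<And>j. T (Suc j) = (T j \<noteq> (L (Suc j) \<noteq> 2))" 
      using forward_signs[of "\<not> \<sigma>2" "\<lambda>j. L (Suc j) \<noteq> 2"] by blast
    define S where "S = (\<lambda>j. if j = 0 \<or> j = k then \<sigma> else T (j - 1))"
    have S: "S 0 = \<sigma>" "S k = \<sigma>" "S 1 = (\<not> \<sigma>2)" using 3 T by (auto simp: S_def)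
    have S': "S (Suc j) = (S j \<noteq> (L j \<noteq> 2))" if "0 < j" "Suc j < k" for j
      using T(2)[of "j - 1"] that by (simp add: S_def)
    have "ear_ok k 2 k2 e p \<sigma> \<sigma>2 K L S"
      unfolding ear_ok_def
    proof (intro conjI allI impI)
      fix j assume j: "j < k" "L j = 2"
      then have "0 < j" "j \<noteq> k - 1" using 3 L by (auto intro!: Nat.gr0I)
      then show "S j = S (Suc j)" using S'[of j] j by auto
    next
      fix j assume j: "j < k" "L j \<noteq> 2" "K j \<noteq> 2" "K (Suc j) \<noteq> 2"
      then have "j \<noteq> 0" "Suc j \<noteq> k" using K(1,2) by (intro notI; simp)+
      then have "0 < j" "Suc j < k" using j(1) by auto
      then show "S j \<noteq> S (Suc j) \<or> k \<le> 3 \<and> (\<forall>i<k. i \<noteq> j \<longrightarrow> L i = 2)"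
        using S'[of j] j by simp
    qed (use 3 K K2 L S lt in \<open>auto\<close>)
    then show ?thesis by blast
  next
    case 4
    then have n: "0 < (2::nat)" "2 \<le> k - 2" using lt by auto
    from even_label_walk[OF n, of \<sigma>] obtain L :: "nat \<Rightarrow> nat" and S where LS: 
      "L 0 = 2 \<and> L (k - 2) = 0 \<and> (\<forall>j. L j < 3) \<and> (\<forall>j<k - 2. L (Suc j) \<noteq> L j) \<and>
        S 0 = \<sigma> \<and> S (k - 2) = \<sigma> \<and> (\<forall>j<k - 2. S (Suc j) = (S j \<noteq> (L (Suc j) \<noteq> 2)))" by (elim exE)
    have L: "L 0 = 2" "L (k - 2) = 0" "\<And>j. L j < 3" "\<And>j. j < k - 2 \<Longrightarrow> L (Suc j) \<noteq> L j"
      "S 0 = \<sigma>" "S (k - 2) = \<sigma>" "\<And>j. j < k - 2 \<Longrightarrow> S (Suc j) = (S j \<noteq> (L (Suc j) \<noteq> 2))"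
      using LS by simp_all
    \<comment> \<open>The walk stops at 0 one step early so that a final label 2 can follow; it
      keeps the sign, which has already returned to \<open>\<sigma>\<close>.\<close>
    define L' where "L' = (\<lambda>j. if j = k - 1 then 2 else L j)"
    define S' where "S' = (\<lambda>j. if j = k then \<sigma> else S (j - 1))"
    have L': "L' 0 = 2" "L' (k - 1) = 2" "\<And>j. L' j < 3" "\<And>j. Suc j < k \<Longrightarrow> L' (Suc j) \<noteq> L' j"
    proof -
      fix j assume j: "Suc j < k"
      show "L' (Suc j) \<noteq> L' j"
      proof (cases "Suc j = k - 1")
        case True
        then have "j = k - 2" by auto
        then show ?thesis using True L(2) 4 by (auto simp: L'_def)
      qed (use L(4)[of j] j in \<open>auto simp: L'_def\<close>)
    qed (use 4 L in \<open>auto simp: L'_def\<close>)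
    have S'S: "S' (Suc j) = (S' j \<noteq> (L' j \<noteq> 2))" if "j < k" for j
    proof -
      have "j = 0 \<or> j = k - 1 \<or> (\<exists>i. j = Suc i \<and> Suc j < k)"
        using that by (cases j; cases "Suc j = k") auto
      then consider "j = 0" | "j = k - 1" | i where "j = Suc i" "Suc j < k" by blast
      then show ?thesis
      proof cases
        case 1
        then show ?thesis using L L' 4 by (simp add: S'_def)
      next
        case 2
        moreover have "j - 1 = k - 2" using 2 by auto
        ultimately show ?thesis using L L' 4 by (simp add: S'_def)
      next
        case 3
        then show ?thesis using L(7)[of i] that by (auto simp: S'_def L'_def)
      qed
    qed
    have "ear_ok k 2 k2 e p \<sigma> \<sigma>2 K L' S'"
      unfolding ear_ok_def
    proof (intro conjI allI impI)
      show "S' j = S' (Suc j)" if "j < k" "L' j = 2" for j using S'S[of j] that by blast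
    next
      show "S' j \<noteq> S' (Suc j) \<or> k \<le> 3 \<and> (\<forall>i<k. i \<noteq> j \<longrightarrow> L' i = 2)" 
        if "j < k" "L' j \<noteq> 2" for j using S'S[of j] that by blast
    qed (use 4 K K2 L(5) L' lt in \<open>auto simp: S'_def\<close>)
    then show ?thesis by blast
  qed
qed

text \<open>For even \<open>k \<ge> 4\<close> the classes 0 and 1 alternate around the whole face,
  so evenly many labels must differ from 2; the cases provide such walks from \<open>e\<close> to
  \<open>t\<close>, according to which of the two is 2.\<close>

lemma ear_labels_before:
  assumes k: "k \<ge> 2" and lt: "kv < 2" "e < 3" "p < 3"
  shows "\<exists>K L S. ear_ok k kv 2 e p \<sigma> \<sigma>2 K L S"
proof -
  obtain t :: nat where t: "t < 3" "t \<noteq> e" "t \<noteq> p" by (rule third_label)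
  have kv: "1 - kv < 2" "1 - kv \<noteq> kv" "1 - kv \<noteq> 2" "kv \<noteq> 2" using lt by arith+
  have D: "k = 2 \<or> k = 3 \<or> (even k \<and> k \<ge> 4) \<or> (odd k \<and> k \<ge> 5)" using k by presburger
  consider "k = 2" | "k = 3" | "even k" "k \<ge> 4" "e = 2" | "even k" "k \<ge> 4" "e \<noteq> 2" "t = 2" 
    | "even k" "k \<ge> 4" "e \<noteq> 2" "t \<noteq> 2" | "odd k" "k \<ge> 5"
    using D by blast
  then show ?thesis
  proof cases
    case 1
    \<comment> \<open>If one of \<open>e\<close> and \<open>t\<close> is 2, all signs agree and the
      vertex with the other label is excused; otherwise the sign flips twice.\<close>
    have "ear_ok k kv 2 e p \<sigma> \<sigma>2 (\<lambda>j. if even j then kv else 1 - kv) (\<lambda>j. if j = 0 then e else t) 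
        (\<lambda>j. if j = 1 \<and> e \<noteq> 2 \<and> t \<noteq> 2 then \<not> \<sigma> else \<sigma>)"
      using lt t kv by (auto simp: 1 ear_ok_def all_less_2 all_less_3)
    then show ?thesis by blast
  next
    case 2
    have "ear_ok k kv 2 e p \<sigma> \<sigma>2 (\<lambda>j. if j = 1 then 1 - kv else if j = 2 then 2 else kv) (\<lambda>j. if j = 0 then e else t) 
        (\<lambda>j. if j = 1 \<and> e \<noteq> 2 \<and> t \<noteq> 2 then \<not> \<sigma> else \<sigma>)"
      using lt t kv by (auto simp: 2 ear_ok_def all_less_2 all_less_3)
    then show ?thesis by blast
  next
    case 3
    then have n: "t < (2::nat)" "2 \<le> k - 1" using lt t by auto
    from even_label_walk[OF n, of \<sigma>] obtain L S where LS: 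
      "L 0 = 2 \<and> L (k - 1) = t \<and> (\<forall>j. L j < 3) \<and> (\<forall>j<k - 1. L (Suc j) \<noteq> L j) \<and>
        S 0 = \<sigma> \<and> S (k - 1) = \<sigma> \<and> (\<forall>j<k - 1. S (Suc j) = (S j \<noteq> (L (Suc j) \<noteq> 2)))" by (elim exE)
    have L: "L 0 = 2" "L (k - 1) = t" "\<And>j. L j < 3" "\<And>j. j < k - 1 \<Longrightarrow> L (Suc j) \<noteq> L j"
      "S 0 = \<sigma>" "S (k - 1) = \<sigma>" "\<And>j. j < k - 1 \<Longrightarrow> S (Suc j) = (S j \<noteq> (L (Suc j) \<noteq> 2))"
      using LS by simp_all
    have S: "S (j - 1) \<noteq> S (Suc j - 1) \<longleftrightarrow> L j \<noteq> 2" if "j < k" for j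
      using L(7)[of "j - 1"] that L(1,5) by (cases j) auto
    have "ear_ok k kv 2 e p \<sigma> \<sigma>2 (\<lambda>j. if even j then kv else 1 - kv) L (\<lambda>j. S (j - 1))"
      unfolding ear_ok_def
    proof (intro conjI allI impI)
      show "S (j - 1) = S (Suc j - 1)" if "j < k" "L j = 2" for j using S[of j] that by blast
    next
      show "S (j - 1) \<noteq> S (Suc j - 1) \<or> k \<le> 3 \<and> (\<forall>i<k. i \<noteq> j \<longrightarrow> L i = 2)" 
        if "j < k" "L j \<noteq> 2" for j using S[of j] that by blast
    qed (use 3 lt t kv L(1-6) in \<open>auto split: if_splits\<close>)
    then show ?thesis by blast
  next
    case 4
    then have n: "e < (2::nat)" "2 \<le> k - 1" using lt t by auto
    from even_label_walk[OF n, of \<sigma>] obtain L S where LS: 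
      "L 0 = 2 \<and> L (k - 1) = e \<and> (\<forall>j. L j < 3) \<and> (\<forall>j<k - 1. L (Suc j) \<noteq> L j) \<and>
        S 0 = \<sigma> \<and> S (k - 1) = \<sigma> \<and> (\<forall>j<k - 1. S (Suc j) = (S j \<noteq> (L (Suc j) \<noteq> 2)))" by (elim exE)
    have L: "L 0 = 2" "L (k - 1) = e" "\<And>j. L j < 3" "\<And>j. j < k - 1 \<Longrightarrow> L (Suc j) \<noteq> L j"
      "S 0 = \<sigma>" "S (k - 1) = \<sigma>" "\<And>j. j < k - 1 \<Longrightarrow> S (Suc j) = (S j \<noteq> (L (Suc j) \<noteq> 2))"
      using LS by simp_all
    \<comment> \<open>Since now the last label \<open>t\<close> is 2, the walk from 2 to
      \<open>e\<close> is run backwards.\<close>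
    define L' where "L' = (\<lambda>j. L (k - 1 - j))"
    define S' where "S' = (\<lambda>j. if j = k then \<sigma> else S (k - 1 - j))"
    have L': "L' 0 = e" "L' (k - 1) = 2" "\<And>j. L' j < 3" using L by (auto simp: L'_def)
    have L'': "L' (Suc j) \<noteq> L' j" if "Suc j < k" for j
    proof -
      have "Suc (k - 1 - Suc j) = k - 1 - j" "k - 1 - Suc j < k - 1" using that by linarith+
      then show ?thesis using L(4)[of "k - 1 - Suc j"] unfolding L'_def by simp
    qed
    have S': "S' 0 = \<sigma>" "S' k = \<sigma>" using L 4 by (auto simp: S'_def)
    have S'S: "S' j \<noteq> S' (Suc j) \<longleftrightarrow> L' j \<noteq> 2" if "j < k" for j
    proof (cases "Suc j = k")
      case True
      then show ?thesis using L by (auto simp: S'_def L'_def)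
    next
      case False
      then have "Suc (k - 1 - Suc j) = k - 1 - j" "k - 1 - Suc j < k - 1" using that by linarith+
      then show ?thesis using L(7)[of "k - 1 - Suc j"] that False unfolding L'_def S'_def by auto
    qed
    have "ear_ok k kv 2 e p \<sigma> \<sigma>2 (\<lambda>j. if even j then kv else 1 - kv) L' S'"
      unfolding ear_ok_def
    proof (intro conjI allI impI)
      show "S' j = S' (Suc j)" if "j < k" "L' j = 2" for j using S'S[of j] that by blast
    next
      show "S' j \<noteq> S' (Suc j) \<or> k \<le> 3 \<and> (\<forall>i<k. i \<noteq> j \<longrightarrow> L' i = 2)" 
        if "j < k" "L' j \<noteq> 2" for j using S'S[of j] that by blast
    qed (use 4 lt t kv L' L'' S' in \<open>auto split: if_splits\<close>)
    then show ?thesis by blast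
  next
    case 5
    \<comment> \<open>All \<open>k\<close> labels differ from 2 and \<open>k\<close> is even, so the
      signs simply alternate.\<close>
    have "ear_ok k kv 2 e p \<sigma> \<sigma>2 (\<lambda>j. if even j then kv else 1 - kv) (\<lambda>j. if even j then e else t) (\<lambda>j. \<sigma> \<noteq> odd j)"
      unfolding ear_ok_def
      by (intro conjI allI impI) (use 5 lt t kv in \<open>auto split: if_splits\<close>)
    then show ?thesis by blast
  next
    case 6
    \<comment> \<open>With the label \<open>q\<close>, which is not 2, on both sides of the class-2
      vertex \<open>b\<^sub>2\<close>, the signs before and after \<open>b\<^sub>2\<close> are
      independent. For \<open>k = 3\<close> this label would also be the last one and would have to
      avoid \<open>p\<close>.\<close>
    define q :: nat where "q = (if e = 0 then 1 else 0)"
    have q: "q < 2" "q \<noteq> e" by (auto simp: q_def)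
    obtain L where L: "L 0 = q" "L (k - 3) = t" "\<And>j. L j < 3" "\<And>j. j < k - 3 \<Longrightarrow> L (Suc j) \<noteq> L j"
      using label_walk[of q t "k - 3"] q t 6 by force
    define L' where "L' = (\<lambda>j. if j = 0 then e else L (j - 2))"
    have L': "L' 0 = e" "L' 1 = q" "L' 2 = q" "L' (k - 1) = t" "\<And>j. L' j < 3" 
    proof -
      have "k - 1 - 2 = k - 3" by simp
      then show "L' (k - 1) = t" using L(2) 6 by (simp add: L'_def)
    qed (use L lt 6 in \<open>auto simp: L'_def\<close>)
    have L'': "L' (Suc j) \<noteq> L' j" if "Suc j < k" "j \<noteq> 1" for j
    proof (cases "j = 0")
      case True
      then show ?thesis using L' q by simp
    next
      case False
      then have "Suc (j - 2) = Suc j - 2" "j - 2 < k - 3" using that by auto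
      then show ?thesis using L(4)[of "j - 2"] False by (simp add: L'_def)
    qed
    obtain T where T: "T k = \<sigma>" "\<And>j. j < k \<Longrightarrow> T j = (T (Suc j) \<noteq> (L' j \<noteq> 2))" 
      using backward_signs[of k \<sigma> "\<lambda>j. L' j \<noteq> 2"] by blast
    define S where "S = (\<lambda>j. if j = 0 then \<sigma> else if j = 1 then (e \<noteq> 2) \<noteq> \<sigma> else T j)"
    define K where "K = (\<lambda>j::nat. if j = 0 then kv else if j = 1 then 1 - kv else if j = 2 then 2 
      else if odd j then kv else 1 - kv)"
    have K: "K 0 = kv" "K k = kv" "K 1 \<noteq> 2" "K 2 = 2" "\<And>j. j \<noteq> 2 \<Longrightarrow> K j \<noteq> 2" "\<And>j. K j < 3" "\<And>j. K j \<noteq> K (Suc j)"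
      using 6 lt kv by (auto simp: K_def)
    have Sk: "S 0 = \<sigma>" "S k = \<sigma>" using T(1) 6 by (auto simp: S_def)
    have S: "S j \<noteq> S (Suc j) \<longleftrightarrow> L' j \<noteq> 2" if "j < k" "j \<noteq> 1" "j \<noteq> 2" for j
      using T(2)[of j] that L'(1) by (cases "j = 0") (auto simp: S_def)
    have "ear_ok k kv 2 e p \<sigma> \<sigma>2 K L' S"
      unfolding ear_ok_def
    proof (intro conjI allI impI)
      fix j assume "Suc j < k" "K (Suc j) = 2"
      then have "j = 1" using K(5)[of "Suc j"] by auto
      then show "L' (Suc j) = L' j" using L'(2,3) by (simp add: numeral_2_eq_2)
    next
      fix j assume j: "Suc j < k" "K (Suc j) \<noteq> 2"
      then have "j \<noteq> 1" using K(4) by (auto simp: numeral_2_eq_2)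
      then show "L' (Suc j) \<noteq> L' j \<or> k = 2 \<and> kv = 2" using L''[of j] j by simp
    next
      fix j assume j: "j < k" "L' j = 2"
      then have "j \<noteq> 1" "j \<noteq> 2" using L'(2,3) q by auto
      then show "S j = S (Suc j)" using S[of j] j by simp
    next
      fix j assume j: "j < k" "L' j \<noteq> 2" "K j \<noteq> 2" "K (Suc j) \<noteq> 2"
      then have "j \<noteq> 1" "j \<noteq> 2" using K(4) by (auto simp: numeral_2_eq_2)
      then show "S j \<noteq> S (Suc j) \<or> k \<le> 3 \<and> (\<forall>i<k. i \<noteq> j \<longrightarrow> L' i = 2)" using S[of j] j by simp
    qed (use 6 K(1,2,3,6,7) L'(1,4,5) Sk t lt in auto)
    then show ?thesis by blast
  qed
qed

lemma ear_labels:
  assumes "k \<ge> 2" "kv < 3" "k2 < 3" "kv \<noteq> k2" "e < 3" "p < 3" "kv \<noteq> 2 \<Longrightarrow> k2 \<noteq> 2 \<Longrightarrow> p \<noteq> e"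
  shows "\<exists>K L S. ear_ok k kv k2 e p \<sigma> \<sigma>2 K L S"
proof -
  consider "kv = 2" | "k2 = 2" | "kv < 2" "k2 < 2" using assms by linarith
  then show ?thesis
    using ear_labels_next[of k kv k2 e p] ear_labels_here[of k k2 e p] ear_labels_before[of k kv e p] assms 
    by cases auto
qed

section \<open>Good labellings\<close>

text \<open>
  Around a vertex outside class 2 the labels may repeat, and the sign need not flip, if the
  two occurrences come from the same vertex of class 2; this happens in faces of length 4 and 6.
\<close>

definition siblings :: "('a \<Rightarrow> 'a \<Rightarrow> bool) \<Rightarrow> 'a set \<Rightarrow> ('a \<Rightarrow> nat) \<Rightarrow> 'a \<Rightarrow> 'a \<Rightarrow> bool" where
  "siblings E W \<kappa> a a' \<longleftrightarrow> a = a' \<or> (\<exists>x\<in>W. \<kappa> x = 2 \<and> E a x \<and> E a' x)"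

text \<open>Neighbourhoods are taken inside \<open>W\<close>, the part built so far. The last
  exception is harmless: if a walk of length 6 through \<open>b\<close> and \<open>b'\<close> joined
  class-2 vertices whose neighbours have label 2, both of its ends would be adjacent to
  \<open>a2\<close>, hence equal.\<close>

definition good_labelling ::
    "('a \<Rightarrow> 'a \<Rightarrow> bool) \<Rightarrow> ('a \<Rightarrow> bool) \<Rightarrow> 'a set \<Rightarrow> ('a \<Rightarrow> nat) \<Rightarrow> ('a \<Rightarrow> nat) \<Rightarrow> ('a \<Rightarrow> bool) \<Rightarrow> bool" where
  "good_labelling E A W \<kappa> \<xi> s \<longleftrightarrow>
     (\<forall>b\<in>W. \<not> A b \<longrightarrow> \<kappa> b < 3) \<and> (\<forall>a\<in>W. A a \<longrightarrow> \<xi> a < 3) \<and>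
     (\<forall>a\<in>W. \<forall>b\<in>W. \<forall>b'\<in>W. A a \<longrightarrow> E a b \<longrightarrow> E a b' \<longrightarrow> \<kappa> b = \<kappa> b' \<longrightarrow> b = b') \<and>
     (\<forall>b\<in>W. \<forall>a\<in>W. \<forall>a'\<in>W. A a \<longrightarrow> E a b \<longrightarrow> E a' b \<longrightarrow> \<kappa> b = 2 \<longrightarrow> \<xi> a = \<xi> a') \<and>
     (\<forall>b\<in>W. \<forall>a\<in>W. \<forall>a'\<in>W. A a \<longrightarrow> E a b \<longrightarrow> E a' b \<longrightarrow> \<kappa> b \<noteq> 2 \<longrightarrow> \<xi> a = \<xi> a' \<longrightarrow> siblings E W \<kappa> a a') \<and>
     (\<forall>a\<in>W. \<forall>b\<in>W. \<forall>b'\<in>W. A a \<longrightarrow> E a b \<longrightarrow> E a b' \<longrightarrow> \<xi> a = 2 \<longrightarrow> s b = s b') \<and>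
     (\<forall>a\<in>W. \<forall>b\<in>W. \<forall>b'\<in>W. A a \<longrightarrow> E a b \<longrightarrow> E a b' \<longrightarrow> \<xi> a \<noteq> 2 \<longrightarrow> \<kappa> b \<noteq> 2 \<longrightarrow> \<kappa> b' \<noteq> 2 \<longrightarrow> b \<noteq> b' \<longrightarrow>
        s b \<noteq> s b' \<or> (\<exists>a1\<in>W. \<exists>a2\<in>W. E a1 b \<and> E a2 b' \<and> \<xi> a1 = 2 \<and> siblings E W \<kappa> a1 a2))"

section \<open>Extending a good labelling along an attached path\<close>

lemma card_le_2D:
  assumes "card {x \<in> W. P x} \<le> 2" "finite W" "x \<in> W" "y \<in> W" "z \<in> W" "P x" "P y" "P z" 
  shows "x = y \<or> y = z \<or> x = z"
proof (rule ccontr)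
  assume "\<not> ?thesis"
  then have "card {x, y, z} = 3" by auto
  moreover have "card {x, y, z} \<le> card {x \<in> W. P x}" using assms by (intro card_mono) auto
  ultimately show False using assms(1) by simp
qed

text \<open>Apart from each other, \<open>a 0\<close> and \<open>b 0\<close> have at most one old
  neighbour each, so \<open>k2\<close>, \<open>\<sigma>2\<close> and \<open>p\<close> record all old
  data that the new labels could conflict with.\<close>

lemma good_labelling_ear:
  assumes sym: "\<And>x y. E x y \<Longrightarrow> E y x" and bip: "\<And>x y. E x y \<Longrightarrow> A x \<noteq> A y"
    and good: "good_labelling E A W \<kappa> \<xi> s" and fin: "finite W" and k: "k \<ge> 2"
    and Aa: "\<And>j. j < k \<Longrightarrow> A (a j)" and Ab: "\<And>j. j \<le> k \<Longrightarrow> \<not> A (b j)" 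
    and old: "a 0 \<in> W" "b 0 \<in> W" "b k = b 0" "E (a 0) (b 0)"
    and new: "\<And>j. 1 \<le> j \<Longrightarrow> j < k \<Longrightarrow> a j \<notin> W \<and> b j \<notin> W" 
    and inj: "inj_on a {..<k}" "inj_on b {..<k}"
    and W': "W' = W \<union> a ` {1..<k} \<union> b ` {1..<k}"
    and Nb: "\<And>j x. 1 \<le> j \<Longrightarrow> j < k \<Longrightarrow> x \<in> W' \<Longrightarrow> E x (b j) \<longleftrightarrow> x = a (j - 1) \<or> x = a j"
    and Na: "\<And>j x. 1 \<le> j \<Longrightarrow> j < k \<Longrightarrow> x \<in> W' \<Longrightarrow> E (a j) x \<longleftrightarrow> x = b j \<or> x = b (Suc j)"
    and deg: "card {x \<in> W. E (a 0) x} \<le> 2" "card {x \<in> W. E x (b 0)} \<le> 2"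
  shows "\<exists>\<kappa>' \<xi>' s'. good_labelling E A W' \<kappa>' \<xi>' s'"
proof -
  note g1 = good[unfolded good_labelling_def]
  note g2 = conjunct2[OF g1]
  note g3 = conjunct2[OF g2]
  note g4 = conjunct2[OF g3]
  note g5 = conjunct2[OF g4]
  note g6 = conjunct2[OF g5]
  note g7 = conjunct2[OF g6]
  have C1: "\<And>y x x'. y \<in> W \<Longrightarrow> x \<in> W \<Longrightarrow> x' \<in> W \<Longrightarrow> A y \<Longrightarrow> E y x \<Longrightarrow> E y x' \<Longrightarrow> \<kappa> x = \<kappa> x' \<Longrightarrow> x = x'"
    using conjunct1[OF g3] by blast
  have C2: "\<And>x y y'. x \<in> W \<Longrightarrow> y \<in> W \<Longrightarrow> y' \<in> W \<Longrightarrow> A y \<Longrightarrow> E y x \<Longrightarrow> E y' x \<Longrightarrow> \<kappa> x = 2 \<Longrightarrow> \<xi> y = \<xi> y'"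
    using conjunct1[OF g4] by blast
  have C3: "\<And>x y y'. x \<in> W \<Longrightarrow> y \<in> W \<Longrightarrow> y' \<in> W \<Longrightarrow> A y \<Longrightarrow> E y x \<Longrightarrow> E y' x \<Longrightarrow> \<kappa> x \<noteq> 2 \<Longrightarrow> \<xi> y = \<xi> y' \<Longrightarrow> siblings E W \<kappa> y y'"
    using conjunct1[OF g5] by blast
  have C4: "\<And>y x x'. y \<in> W \<Longrightarrow> x \<in> W \<Longrightarrow> x' \<in> W \<Longrightarrow> A y \<Longrightarrow> E y x \<Longrightarrow> E y x' \<Longrightarrow> \<xi> y = 2 \<Longrightarrow> s x = s x'"
    using conjunct1[OF g6] by blast
  have C5: "\<And>y x x'. y \<in> W \<Longrightarrow> x \<in> W \<Longrightarrow> x' \<in> W \<Longrightarrow> A y \<Longrightarrow> E y x \<Longrightarrow> E y x' \<Longrightarrow> \<xi> y \<noteq> 2 \<Longrightarrow> \<kappa> x \<noteq> 2 \<Longrightarrow> \<kappa> x' \<noteq> 2 \<Longrightarrow> x \<noteq> x' \<Longrightarrow>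
    s x \<noteq> s x' \<or> (\<exists>a1\<in>W. \<exists>a2\<in>W. E a1 x \<and> E a2 x' \<and> \<xi> a1 = 2 \<and> siblings E W \<kappa> a1 a2)"
    using g7 by blast
  have rng: "\<And>x. x \<in> W \<Longrightarrow> \<not> A x \<Longrightarrow> \<kappa> x < 3" "\<And>y. y \<in> W \<Longrightarrow> A y \<Longrightarrow> \<xi> y < 3" 
    using conjunct1[OF g1] conjunct1[OF g2] by blast+
  have A0: "A (a 0)" "\<not> A (b 0)" using Aa[of 0] Ab[of 0] k by auto
  define kv e \<sigma> where "kv = \<kappa> (b 0)" and "e = \<xi> (a 0)" and "\<sigma> = s (b 0)"
  obtain k2 \<sigma>2 where k2: "k2 < 3" "k2 \<noteq> kv" 
    and v2: "\<And>x. x \<in> W \<Longrightarrow> E (a 0) x \<Longrightarrow> x \<noteq> b 0 \<Longrightarrow> \<kappa> x = k2 \<and> s x = \<sigma>2"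
  proof (cases "\<exists>x\<in>W. E (a 0) x \<and> x \<noteq> b 0")
    case True
    then obtain x where x: "x \<in> W" "E (a 0) x" "x \<noteq> b 0" by blast
    show ?thesis
    proof (rule that[of "\<kappa> x" "s x"])
      show "\<kappa> x < 3" using rng(1)[of x] x bip[OF x(2)] A0 by simp
      show "\<kappa> x \<noteq> kv" using C1[OF old(1) x(1) old(2) A0(1) x(2) old(4)] x(3) by (auto simp: kv_def)
      fix z assume "z \<in> W" "E (a 0) z" "z \<noteq> b 0"
      then have "z = x" using card_le_2D[OF deg(1) fin _ x(1) old(2) _ x(2) old(4)] x(3) by blast
      then show "\<kappa> z = \<kappa> x \<and> s z = s x" by simp
    qed
  next
    case False
    \<comment> \<open>Without a second old neighbour of \<open>a 0\<close> any class other than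
      \<open>kv\<close> can play the role of \<open>k2\<close>.\<close>
    obtain m :: nat where "m < 3" "m \<noteq> kv" "m \<noteq> kv" by (rule third_label)
    then show ?thesis using that[of m undefined] False by blast
  qed
  obtain p where p: "p < 3" "kv \<noteq> 2 \<Longrightarrow> k2 \<noteq> 2 \<Longrightarrow> p \<noteq> e"
    and u2: "\<And>y. y \<in> W \<Longrightarrow> E y (b 0) \<Longrightarrow> y \<noteq> a 0 \<Longrightarrow> \<xi> y = p"
  proof (cases "\<exists>y\<in>W. E y (b 0) \<and> y \<noteq> a 0")
    case True
    then obtain y where y: "y \<in> W" "E y (b 0)" "y \<noteq> a 0" by blast
    show ?thesis
    proof (rule that[of "\<xi> y"])
      show "\<xi> y < 3" using rng(2)[of y] y bip[OF y(2)] A0 by simp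
      \<comment> \<open>Equal labels would make \<open>a 0\<close> and \<open>y\<close> siblings,
        but no old neighbour of \<open>a 0\<close> has class 2 here.\<close>
      show "\<xi> y \<noteq> e" if kv2: "kv \<noteq> 2" "k2 \<noteq> 2"
      proof
        assume "\<xi> y = e"
        then have "siblings E W \<kappa> (a 0) y" using C3[OF old(2) old(1) y(1) A0(1) old(4) y(2)] kv2 by (simp add: kv_def e_def)
        then obtain x where "x \<in> W" "\<kappa> x = 2" "E (a 0) x" using y(3) unfolding siblings_def by blast
        then show False using v2[of x] kv2 by (cases "x = b 0") (auto simp: kv_def)
      qed
      fix z assume "z \<in> W" "E z (b 0)" "z \<noteq> a 0"
      then have "z = y" using card_le_2D[OF deg(2) fin _ y(1) old(1) _ y(2) old(4)] y(3) by blast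
      then show "\<xi> z = \<xi> y" by simp
    qed
  next
    case False
    obtain m :: nat where "m < 3" "m \<noteq> e" "m \<noteq> e" by (rule third_label)
    then show ?thesis using that[of m] False by blast
  qed
  have "kv < 3" "e < 3" using rng(1)[OF old(2) A0(2)] rng(2)[OF old(1) A0(1)] by (auto simp: kv_def e_def)
  then obtain K L S where ok: "ear_ok k kv k2 e p \<sigma> \<sigma>2 K L S"
    using ear_labels[OF k _ k2(1) k2(2)[symmetric] _ p(1) p(2)] by blast
  note ok' = ok[unfolded ear_ok_def]
  note ok1 = ok'[THEN conjunct1]
  note ok2 = ok'[THEN conjunct2, THEN conjunct1]
  note ok3 = ok'[THEN conjunct2, THEN conjunct2, THEN conjunct1]
  note ok4 = ok'[THEN conjunct2, THEN conjunct2, THEN conjunct2, THEN conjunct1]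
  note ok5 = ok'[THEN conjunct2, THEN conjunct2, THEN conjunct2, THEN conjunct2, THEN conjunct1]
  note ok6 = ok'[THEN conjunct2, THEN conjunct2, THEN conjunct2, THEN conjunct2, THEN conjunct2, THEN conjunct1]
  note ok7 = ok'[THEN conjunct2, THEN conjunct2, THEN conjunct2, THEN conjunct2, THEN conjunct2, THEN conjunct2, THEN conjunct1]
  note ok8 = ok'[THEN conjunct2, THEN conjunct2, THEN conjunct2, THEN conjunct2, THEN conjunct2, THEN conjunct2, THEN conjunct2, THEN conjunct1]
  note ok9 = ok'[THEN conjunct2, THEN conjunct2, THEN conjunct2, THEN conjunct2, THEN conjunct2, THEN conjunct2, THEN conjunct2, THEN conjunct2, THEN conjunct1]
  note ok10 = ok'[THEN conjunct2, THEN conjunct2, THEN conjunct2, THEN conjunct2, THEN conjunct2, THEN conjunct2, THEN conjunct2, THEN conjunct2, THEN conjunct2, THEN conjunct1]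
  note ok11 = ok'[THEN conjunct2, THEN conjunct2, THEN conjunct2, THEN conjunct2, THEN conjunct2, THEN conjunct2, THEN conjunct2, THEN conjunct2, THEN conjunct2, THEN conjunct2, THEN conjunct1]
  note ok12 = ok'[THEN conjunct2, THEN conjunct2, THEN conjunct2, THEN conjunct2, THEN conjunct2, THEN conjunct2, THEN conjunct2, THEN conjunct2, THEN conjunct2, THEN conjunct2, THEN conjunct2, THEN conjunct1]
  note ok13 = ok'[THEN conjunct2, THEN conjunct2, THEN conjunct2, THEN conjunct2, THEN conjunct2, THEN conjunct2, THEN conjunct2, THEN conjunct2, THEN conjunct2, THEN conjunct2, THEN conjunct2, THEN conjunct2, THEN conjunct1]
  note ok14 = ok'[THEN conjunct2, THEN conjunct2, THEN conjunct2, THEN conjunct2, THEN conjunct2, THEN conjunct2, THEN conjunct2, THEN conjunct2, THEN conjunct2, THEN conjunct2, THEN conjunct2, THEN conjunct2, THEN conjunct2]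
  have ok7': "K j < 3" "L j < 3" "K j \<noteq> K (Suc j)" if "j < k" for j using ok7 that by blast+
  have ok8': "Suc j < k \<Longrightarrow> K (Suc j) = 2 \<Longrightarrow> L (Suc j) = L j" for j using ok8 by blast
  have ok9': "Suc j < k \<Longrightarrow> K (Suc j) \<noteq> 2 \<Longrightarrow> L (Suc j) = L j \<Longrightarrow> k = 2 \<and> kv = 2" for j using ok9 by blast
  have ok12': "j < k \<Longrightarrow> L j = 2 \<Longrightarrow> S j = S (Suc j)" for j using ok12 by blast
  have ok13': "j < k \<Longrightarrow> L j \<noteq> 2 \<Longrightarrow> K j \<noteq> 2 \<Longrightarrow> K (Suc j) \<noteq> 2 \<Longrightarrow>
    S j \<noteq> S (Suc j) \<or> k \<le> 3 \<and> (\<forall>i<k. i \<noteq> j \<longrightarrow> L i = 2)" for j using ok13 by blast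
  \<comment> \<open>Inverting \<open>b\<close> on \<open>{..<k}\<close> is enough, since the
    remaining vertex \<open>b k\<close> is \<open>b 0\<close>, an element of
    \<open>W\<close>.\<close>
  define \<kappa>' where "\<kappa>' = (\<lambda>x. if x \<in> W then \<kappa> x else K (inv_into {..<k} b x))"
  define \<xi>' where "\<xi>' = (\<lambda>x. if x \<in> W then \<xi> x else L (inv_into {..<k} a x))"
  define s' where "s' = (\<lambda>x. if x \<in> W then s x else S (inv_into {..<k} b x))"
  have oldv: "\<kappa>' x = \<kappa> x" "\<xi>' x = \<xi> x" "s' x = s x" if "x \<in> W" for x
    using that by (auto simp: \<kappa>'_def \<xi>'_def s'_def)
  have Kb: "\<kappa>' (b j) = K j" and Sb: "s' (b j) = S j" if jk: "j \<le> k" for j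
  proof -
    consider "j = 0" | "j = k" | "1 \<le> j" "j < k" using jk by linarith
    then have "\<kappa>' (b j) = K j \<and> s' (b j) = S j"
    proof cases
      case 1
      then show ?thesis using oldv[OF old(2)] ok1 ok4 by (simp add: kv_def \<sigma>_def)
    next
      case 2
      then show ?thesis using oldv[OF old(2)] ok2 ok5 old(3) by (simp add: kv_def \<sigma>_def)
    next
      case 3
      then show ?thesis using new[of j] inv_into_f_f[OF inj(2), of j] by (simp add: \<kappa>'_def s'_def)
    qed
    then show "\<kappa>' (b j) = K j" "s' (b j) = S j" by auto
  qed
  have La: "\<xi>' (a j) = L j" if "j < k" for j
  proof (cases "j = 0")
    case True
    then show ?thesis using oldv[OF old(1)] ok3 by (simp add: e_def)
  next
    case False
    then show ?thesis using new[of j] inv_into_f_f[OF inj(1), of j] that by (simp add: \<xi>'_def)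
  qed
  have inW': "a j \<in> W'" "b j \<in> W'" "b (Suc j) \<in> W'" if "j < k" for j
    using that old W' by (cases "j = 0"; cases "Suc j = k"; auto)+
  have adj: "E (a j) (b j)" "E (a j) (b (Suc j))" if "j < k" for j
  proof -
    show "E (a j) (b j)" using that old Na[of j "b j"] inW'[OF that] by (cases "j = 0") auto
    show "E (a j) (b (Suc j))"
    proof (cases "j = 0")
      case True
      then show ?thesis using Nb[of 1 "a 0"] inW'[of 0] k by simp
    qed (use that Na[of j "b (Suc j)"] inW'[OF that] in simp)
  qed
  have edge: "(x \<in> W \<and> y \<in> W) \<or> (\<exists>j<k. y = a j \<and> (x = b j \<or> x = b (Suc j)))"
    if xy: "x \<in> W'" "y \<in> W'" "E y x" "A y" for x y
  proof -
    have nA: "\<not> A x" using bip[OF xy(3)] xy(4) by simp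
    consider "x \<in> W" "y \<in> W" | j where "1 \<le> j" "j < k" "y = a j" | j where "1 \<le> j" "j < k" "x = b j"
      using xy(1,2,4) nA Aa Ab unfolding W' by (auto simp: less_imp_le)
    then show ?thesis
    proof cases
      case 2
      then show ?thesis using Na[OF 2(1,2) xy(1)] xy(3) by blast
    next
      case 3
      then have "y = a (j - 1) \<or> y = a j" using Nb[OF 3(1,2) xy(2)] xy(3) by blast
      then show ?thesis
      proof
        assume "y = a (j - 1)"
        then show ?thesis using 3 by (intro disjI2 exI[of _ "j - 1"]) auto
      qed (use 3 in blast)
    qed blast
  qed
  have a_eq: "i = j" if "a i = a j" "i < k" "j < k" for i j using that inj(1) by (auto dest: inj_onD)
  have b_eq: "i = j \<or> (i = 0 \<and> j = k) \<or> (i = k \<and> j = 0)" if "b i = b j" "i \<le> k" "j \<le> k" for i j 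
  proof -
    define r where "r = (\<lambda>i. if i = k then 0 else i)"
    have "b (r i) = b (r j)" "r i < k" "r j < k" using that old(3) k by (auto simp: r_def)
    then have "r i = r j" using inj(2) by (auto dest: inj_onD)
    then show ?thesis by (auto simp: r_def split: if_splits)
  qed
  have aW: "j = 0" if "a j \<in> W" "j < k" for j using new[of j] that by (cases "j = 0") auto
  have bW: "j = 0 \<or> j = k" if "b j \<in> W" "j \<le> k" for j using new[of j] that by (cases "j = 0"; cases "j = k") auto
  have sib_mono: "siblings E W' \<kappa>' y y'" if "siblings E W \<kappa> y y'" for y y'
    using that oldv W' unfolding siblings_def by auto
  have sib_sym: "siblings E W' \<kappa>' y' y" if "siblings E W' \<kappa>' y y'" for y y'
    using that unfolding siblings_def by auto
  have sib_b: "siblings E W' \<kappa>' y y'" if "j \<le> k" "K j = 2" "E y (b j)" "E y' (b j)" for y y' j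
  proof -
    have "b j \<in> W'" using that(1) inW'(2)[of j] old W' by (cases "j = k") auto
    then show ?thesis using that Kb[of j] unfolding siblings_def by auto
  qed
  \<comment> \<open>For \<open>k = 2\<close> the other \<open>A\<close>-vertex of the face is
    adjacent to both \<open>b j\<close> and \<open>b (Suc j)\<close>. For \<open>k = 3\<close> the
    other two have a common neighbour in the face, and as both labels are 2, \<open>ear_ok\<close>
    forces class 2 on it.\<close>
  have exempt: "\<exists>a1\<in>W'. \<exists>a2\<in>W'. E a1 (b j) \<and> E a2 (b (Suc j)) \<and> \<xi>' a1 = 2 \<and> \<xi>' a2 = 2 \<and> siblings E W' \<kappa>' a1 a2"
    if j: "j < k" and k3: "k \<le> 3" and oth: "\<And>i. i < k \<Longrightarrow> i \<noteq> j \<Longrightarrow> L i = 2" for j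
  proof -
    have "k = 2 \<or> k = 3" using k k3 by auto
    then show ?thesis
    proof
      assume k2: "k = 2"
      have "E (a (1 - j)) (b j)" "E (a (1 - j)) (b (Suc j))"
        using k2 j adj[of 0] adj[of 1] old(3) by (cases "j = 0"; auto simp: less_Suc_eq numeral_2_eq_2)+
      moreover have "\<xi>' (a (1 - j)) = 2" using La[of "1 - j"] oth[of "1 - j"] j k2 by (cases "j = 0") auto
      moreover have "a (1 - j) \<in> W'" using inW'(1)[of "1 - j"] k2 by simp
      moreover have "siblings E W' \<kappa>' (a (1 - j)) (a (1 - j))" by (simp add: siblings_def)
      ultimately show ?thesis by blast
    next
      assume k3: "k = 3"
      have "Suc 1 = 2" "Suc 2 = 3" by simp_all
      have K: "K 1 = 2" if "L 1 = 2" "L 0 = 2" using ok9'[of 0] that k3 by auto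
      have K': "K 2 = 2" if "L 2 = 2" "L 1 = 2" using ok9'[of 1] that k3 by (auto simp: numeral_2_eq_2)
      have K'': "K 0 = 2" if "L 2 = 2" "L 0 = 2" using ok11 ok3 ok1 that k3 by auto
      have ad: "E (a 0) (b 0)" "E (a 0) (b 1)" "E (a 1) (b 1)" "E (a 1) (b 2)" "E (a 2) (b 2)" "E (a 2) (b 0)"
        using adj(1)[of 0] adj(2)[of 0] adj(1)[of 1] adj(2)[of 1] adj(1)[of 2] adj(2)[of 2] old(3) k3
          by (simp_all add: numeral_2_eq_2 numeral_3_eq_3)
      have b3: "b (Suc 2) = b 0" using old(3) k3 \<open>Suc 2 = 3\<close> by simp
      have aW': "a 0 \<in> W'" "a 1 \<in> W'" "a 2 \<in> W'" using inW'(1) k3 by auto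
      have La3: "\<xi>' (a 0) = L 0" "\<xi>' (a 1) = L 1" "\<xi>' (a 2) = L 2" using La k3 by auto
      consider "j = 0" | "j = 1" | "j = 2" using j k3 by linarith
      then show ?thesis
      proof cases
        case 1
        then have L2: "L 1 = 2" "L 2 = 2" using oth[of 1] oth[of 2] k3 by auto
        then have sb: "siblings E W' \<kappa>' (a 2) (a 1)" using sib_b[OF _ K' ad(5,4)] k3 by simp
        have "E (a 1) (b (Suc j))" "E (a 2) (b j)" using ad 1 by simp_all
        then show ?thesis using sb aW' La3 L2 by metis
      next
        case 2
        then have L2: "L 0 = 2" "L 2 = 2" using oth[of 0] oth[of 2] k3 by auto
        then have sb: "siblings E W' \<kappa>' (a 0) (a 2)" using sib_b[OF _ K'' ad(1,6)] k3 by simp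
        have "E (a 2) (b (Suc j))" "E (a 0) (b j)" using ad 2 by (simp_all add: numeral_2_eq_2)
        then show ?thesis using sb aW' La3 L2 by metis
      next
        case 3
        then have L2: "L 0 = 2" "L 1 = 2" using oth[of 0] oth[of 1] k3 by auto
        then have sb: "siblings E W' \<kappa>' (a 1) (a 0)" using sib_b[OF _ K ad(3,2)] k3 by simp
        have "E (a 0) (b (Suc j))" "E (a 1) (b j)" using ad 3 b3 by simp_all
        then show ?thesis using sb aW' La3 L2 by metis
      qed
    qed
  qed
  \<comment> \<open>Two neighbours of an \<open>A\<close>-vertex are equal, both old, consecutive in
    the face, or \<open>b 1\<close> and the second old neighbour of \<open>a 0\<close>; a reflexive
    symmetric relation has to be checked only there.\<close>
  have pairA: "P x x'"
    if y: "x \<in> W'" "x' \<in> W'" "y \<in> W'" "A y" "E y x" "E y x'"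
      and symP: "\<And>x x'. P x x' \<Longrightarrow> P x' x" and reflP: "\<And>x. P x x"
      and oldP: "y \<in> W \<Longrightarrow> x \<in> W \<Longrightarrow> x' \<in> W \<Longrightarrow> P x x'"
      and stepP: "\<And>j. j < k \<Longrightarrow> y = a j \<Longrightarrow> P (b j) (b (Suc j))"
      and mixP: "\<And>z. y = a 0 \<Longrightarrow> z \<in> W \<Longrightarrow> E (a 0) z \<Longrightarrow> z \<noteq> b 0 \<Longrightarrow> P (b 1) z"
    for P y x x'
  proof -
    have mix: "P z w" if z: "z \<in> W" "y \<in> W" "E y z" and w: "j < k" "y = a j" "w = b j \<or> w = b (Suc j)"
      "w \<in> W \<Longrightarrow> P z w" for z w j
    proof -
      have j: "j = 0" using aW[of j] w z by simp
      show ?thesis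
      proof (cases "w = b 0")
        case False
        then have w1: "w = b 1" using w j by auto
        show ?thesis
        proof (cases "z = b 0")
          case True
          then show ?thesis using stepP[of 0] w j w1 by simp
        next
          case False
          then show ?thesis using symP[OF mixP[of z]] w j w1 z by simp
        qed
      qed (use w old in simp)
    qed
    from edge[OF y(1,3,5,4)] edge[OF y(2,3,6,4)] show ?thesis
    proof (elim disjE exE conjE)
      assume "x \<in> W" "y \<in> W" "x' \<in> W"
      then show ?thesis using oldP by blast
    next
      fix j assume j: "x \<in> W" "y \<in> W" "j < k" "y = a j" "x' = b j"
      show ?thesis by (rule mix[of x j x']) (use j y oldP in auto)
    next
      fix j assume j: "x \<in> W" "y \<in> W" "j < k" "y = a j" "x' = b (Suc j)"
      show ?thesis by (rule mix[of x j x']) (use j y oldP in auto)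
    next
      fix j assume j: "x' \<in> W" "y \<in> W" "j < k" "y = a j" "x = b j"
      show ?thesis by (rule symP, rule mix[of x' j x]) (use j y symP[OF oldP] in auto)
    next
      fix j assume j: "x' \<in> W" "y \<in> W" "j < k" "y = a j" "x = b (Suc j)"
      show ?thesis by (rule symP, rule mix[of x' j x]) (use j y symP[OF oldP] in auto)
    next
      fix i j assume ij: "i < k" "y = a i" "x = b i" "j < k" "y = a j" "x' = b j"
      have eq: "i = j" by (rule a_eq[OF _ ij(1,4)]) (metis ij(2,5))
      show ?thesis unfolding ij(3,6) eq by (rule reflP)
    next
      fix i j assume ij: "i < k" "y = a i" "x = b i" "j < k" "y = a j" "x' = b (Suc j)"
      have eq: "i = j" by (rule a_eq[OF _ ij(1,4)]) (metis ij(2,5))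
      show ?thesis unfolding ij(3,6) eq by (rule stepP[OF ij(4,5)])
    next
      fix i j assume ij: "i < k" "y = a i" "x = b (Suc i)" "j < k" "y = a j" "x' = b j"
      have eq: "i = j" by (rule a_eq[OF _ ij(1,4)]) (metis ij(2,5))
      show ?thesis unfolding ij(3,6) eq by (rule symP[OF stepP[OF ij(4,5)]])
    next
      fix i j assume ij: "i < k" "y = a i" "x = b (Suc i)" "j < k" "y = a j" "x' = b (Suc j)"
      have eq: "i = j" by (rule a_eq[OF _ ij(1,4)]) (metis ij(2,5))
      show ?thesis unfolding ij(3,6) eq by (rule reflP)
    qed
  qed
  \<comment> \<open>The analogue for \<open>B\<close>-vertices; the face closes at
    \<open>b 0\<close>, where \<open>a (k - 1)\<close> meets \<open>a 0\<close> and possibly a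
    second old neighbour.\<close>
  have pairB: "P y y'"
    if y: "y \<in> W'" "y' \<in> W'" "x \<in> W'" "A y" "A y'" "E y x" "E y' x"
      and symP: "\<And>y y'. P y y' \<Longrightarrow> P y' y" and reflP: "\<And>y. P y y"
      and oldP: "x \<in> W \<Longrightarrow> y \<in> W \<Longrightarrow> y' \<in> W \<Longrightarrow> P y y'"
      and stepP: "\<And>j. Suc j < k \<Longrightarrow> x = b (Suc j) \<Longrightarrow> P (a j) (a (Suc j))"
      and endP: "x = b 0 \<Longrightarrow> P (a 0) (a (k - 1))"
      and mixP: "\<And>z. x = b 0 \<Longrightarrow> z \<in> W \<Longrightarrow> E z (b 0) \<Longrightarrow> z \<noteq> a 0 \<Longrightarrow> P z (a (k - 1))"
    for P y y' x
  proof -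
    have new: "P (a i) (a j)" if ij: "i < k" "j < k" "p = i \<or> p = Suc i" "q = j \<or> q = Suc j" "x = b p" "x = b q" for i j p q
    proof -
      have "p = q \<or> (p = 0 \<and> q = k) \<or> (p = k \<and> q = 0)" using b_eq[of p q] ij by auto
      then consider "i = j" | "j = Suc i" "x = b j" | "i = Suc j" "x = b i" | "i = 0" "j = k - 1" "x = b 0" | "j = 0" "i = k - 1" "x = b 0"
        using ij by auto
      then show ?thesis 
      proof cases
        case 3
        then show ?thesis using symP[OF stepP[of j]] ij by simp
      next
        case 5
        then show ?thesis using symP[OF endP] by simp
      qed (use ij reflP stepP endP in auto)
    qed
    have mix: "P z w" if z: "z \<in> W" "x \<in> W" "E z x" and w: "j < k" "w = a j" "x = b j \<or> x = b (Suc j)"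
      "w \<in> W \<Longrightarrow> P z w" for z w j
    proof -
      consider "j = 0" | "Suc j = k" "x = b 0" using w z(2) bW[of j] bW[of "Suc j"] old(3) by (cases "j = 0") auto
      then show ?thesis
      proof cases
        case 1
        then show ?thesis using w old by simp
      next
        case 2
        then have j: "j = k - 1" by simp
        show ?thesis using endP[OF 2(2)] mixP[OF 2(2) z(1)] z(3) 2(2) j w(2) by (cases "z = a 0") auto
      qed
    qed
    from edge[OF y(3,1,6,4)] edge[OF y(3,2,7,5)] show ?thesis
    proof (elim disjE exE conjE)
      assume "x \<in> W" "y \<in> W" "y' \<in> W"
      then show ?thesis using oldP by blast
    next
      fix j assume j: "x \<in> W" "y \<in> W" "j < k" "y' = a j" "x = b j"
      show ?thesis by (rule mix[of y j y']) (use j y oldP in auto)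
    next
      fix j assume j: "x \<in> W" "y \<in> W" "j < k" "y' = a j" "x = b (Suc j)"
      show ?thesis by (rule mix[of y j y']) (use j y oldP in auto)
    next
      fix j assume j: "x \<in> W" "y' \<in> W" "j < k" "y = a j" "x = b j"
      show ?thesis by (rule symP, rule mix[of y' j y]) (use j y symP[OF oldP] in auto)
    next
      fix j assume j: "x \<in> W" "y' \<in> W" "j < k" "y = a j" "x = b (Suc j)"
      show ?thesis by (rule symP, rule mix[of y' j y]) (use j y symP[OF oldP] in auto)
    next
      fix i j assume ij: "i < k" "y = a i" "x = b i" "j < k" "y' = a j" "x = b j"
      show ?thesis unfolding ij(2,5) by (rule new[of i j "i" "j"]) (use ij(1,4) ij(3,6) in \<open>simp_all only: simp_thms\<close>)
    next
      fix i j assume ij: "i < k" "y = a i" "x = b i" "j < k" "y' = a j" "x = b (Suc j)"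
      show ?thesis unfolding ij(2,5) by (rule new[of i j "i" "Suc j"]) (use ij(1,4) ij(3,6) in \<open>simp_all only: simp_thms\<close>)
    next
      fix i j assume ij: "i < k" "y = a i" "x = b (Suc i)" "j < k" "y' = a j" "x = b j"
      show ?thesis unfolding ij(2,5) by (rule new[of i j "Suc i" "j"]) (use ij(1,4) ij(3,6) in \<open>simp_all only: simp_thms\<close>)
    next
      fix i j assume ij: "i < k" "y = a i" "x = b (Suc i)" "j < k" "y' = a j" "x = b (Suc j)"
      show ?thesis unfolding ij(2,5) by (rule new[of i j "Suc i" "Suc j"]) (use ij(1,4) ij(3,6) in \<open>simp_all only: simp_thms\<close>)
    qed
  qed
  have "good_labelling E A W' \<kappa>' \<xi>' s'"
    unfolding good_labelling_def
  proof (intro conjI ballI impI)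
    fix x assume x: "x \<in> W'" "\<not> A x"
    then consider "x \<in> W" | j where "1 \<le> j" "j < k" "x = b j" using W' Aa by auto
    then show "\<kappa>' x < 3"
    proof cases
      case 1
      then show ?thesis using rng(1) x oldv by simp
    next
      case 2
      then show ?thesis using Kb[of j] ok7'[of j] by simp
    qed
  next
    fix y assume y: "y \<in> W'" "A y"
    then consider "y \<in> W" | j where "1 \<le> j" "j < k" "y = a j" using W' Ab by (auto simp: less_imp_le)
    then show "\<xi>' y < 3"
    proof cases
      case 1
      then show ?thesis using rng(2) y oldv by simp
    next
      case 2
      then show ?thesis using La[of j] ok7'[of j] by simp
    qed
  next
    fix y x x' assume y: "y \<in> W'" "x \<in> W'" "x' \<in> W'" "A y" "E y x" "E y x'" and eq: "\<kappa>' x = \<kappa>' x'"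
    have "\<kappa>' x = \<kappa>' x' \<longrightarrow> x = x'"
    proof (rule pairA[OF y(2,3,1,4-6), where P = "\<lambda>x x'. \<kappa>' x = \<kappa>' x' \<longrightarrow> x = x'"])
      assume "y \<in> W" "x \<in> W" "x' \<in> W"
      then show "\<kappa>' x = \<kappa>' x' \<longrightarrow> x = x'" using C1[of y x x'] y oldv by auto
    next
      fix j assume "j < k"
      then show "\<kappa>' (b j) = \<kappa>' (b (Suc j)) \<longrightarrow> b j = b (Suc j)" using Kb[of j] Kb[of "Suc j"] ok7'[of j] by simp
    next
      fix z assume "z \<in> W" "E (a 0) z" "z \<noteq> b 0"
      then show "\<kappa>' (b 1) = \<kappa>' z \<longrightarrow> b 1 = z" using v2[of z] oldv[of z] Kb[of 1] ok6 k by simp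
    qed auto
    then show "x = x'" using eq by simp
  next
    fix x y y' assume y: "x \<in> W'" "y \<in> W'" "y' \<in> W'" "A y" "E y x" "E y' x" and x2: "\<kappa>' x = 2"
    have "A y'" using bip[OF y(5)] bip[OF y(6)] y(4) by simp
    then show "\<xi>' y = \<xi>' y'"
    proof (rule pairB[OF y(2,3,1,4) _ y(5,6), where P = "\<lambda>y y'. \<xi>' y = \<xi>' y'"])
      assume "x \<in> W" "y \<in> W" "y' \<in> W"
      then show "\<xi>' y = \<xi>' y'" using C2[of x y y'] y oldv x2 by auto
    next
      fix j assume "Suc j < k" "x = b (Suc j)"
      then show "\<xi>' (a j) = \<xi>' (a (Suc j))" using La[of j] La[of "Suc j"] Kb[of "Suc j"] x2 ok8'[of j] by simp
    next
      assume "x = b 0"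
      then show "\<xi>' (a 0) = \<xi>' (a (k - 1))" using La[of 0] La[of "k - 1"] Kb[of 0] x2 ok1 ok3 ok10 k by simp
    next
      fix z assume z: "x = b 0" "z \<in> W" "E z (b 0)" "z \<noteq> a 0"
      then have "kv = 2" using x2 Kb[of 0] ok1 by simp
      then have "\<xi> (a 0) = \<xi> z" using C2[OF old(2) old(1) z(2) A0(1) old(4) z(3)] by (simp add: kv_def)
      then show "\<xi>' z = \<xi>' (a (k - 1))" using La[of "k - 1"] oldv[OF z(2)] ok10 k \<open>kv = 2\<close> by (simp add: e_def)
    qed auto
  next
    fix x y y' assume y: "x \<in> W'" "y \<in> W'" "y' \<in> W'" "A y" "E y x" "E y' x" and x2: "\<kappa>' x \<noteq> 2" and eq: "\<xi>' y = \<xi>' y'"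
    have "A y'" using bip[OF y(5)] bip[OF y(6)] y(4) by simp
    then have "\<xi>' y = \<xi>' y' \<longrightarrow> siblings E W' \<kappa>' y y'"
    proof (rule pairB[OF y(2,3,1,4) _ y(5,6), where P = "\<lambda>y y'. \<xi>' y = \<xi>' y' \<longrightarrow> siblings E W' \<kappa>' y y'"])
      assume "x \<in> W" "y \<in> W" "y' \<in> W"
      then show "\<xi>' y = \<xi>' y' \<longrightarrow> siblings E W' \<kappa>' y y'" using C3[of x y y'] y oldv x2 sib_mono by auto
    next
      fix j assume j: "Suc j < k" "x = b (Suc j)"
      show "\<xi>' (a j) = \<xi>' (a (Suc j)) \<longrightarrow> siblings E W' \<kappa>' (a j) (a (Suc j))"
      proof
        assume "\<xi>' (a j) = \<xi>' (a (Suc j))"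
        then have "k = 2" "kv = 2" using La[of j] La[of "Suc j"] Kb[of "Suc j"] x2 ok9'[of j] j by simp_all
        then have "j = 0" "E (a 0) (b 0)" "E (a 1) (b 0)" "K 0 = 2" using j adj(1)[of 0] adj(2)[of 1] old(3) ok1 by (simp_all add: numeral_2_eq_2)
        then show "siblings E W' \<kappa>' (a j) (a (Suc j))" using sib_b[of 0 "a 0" "a 1"] by simp
      qed
    next
      assume x: "x = b 0"
      show "\<xi>' (a 0) = \<xi>' (a (k - 1)) \<longrightarrow> siblings E W' \<kappa>' (a 0) (a (k - 1))"
      proof
        assume "\<xi>' (a 0) = \<xi>' (a (k - 1))"
        moreover have "kv \<noteq> 2" using x x2 Kb[of 0] ok1 by simp
        ultimately have "k = 2" "K 1 = 2" using La[of 0] La[of "k - 1"] ok3 ok11 k by simp_all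
        then show "siblings E W' \<kappa>' (a 0) (a (k - 1))" using sib_b[of 1 "a 0" "a 1"] adj(2)[of 0] adj(1)[of 1] by simp
      qed
    next
      fix z assume z: "x = b 0" "z \<in> W" "E z (b 0)" "z \<noteq> a 0"
      then have "kv \<noteq> 2" using x2 Kb[of 0] ok1 by simp
      then show "\<xi>' z = \<xi>' (a (k - 1)) \<longrightarrow> siblings E W' \<kappa>' z (a (k - 1))" 
        using La[of "k - 1"] oldv[OF z(2)] ok11 k u2[OF z(2-4)] by simp
    qed (auto simp: siblings_def)
    then show "siblings E W' \<kappa>' y y'" using eq by simp
  next
    fix y x x' assume y: "y \<in> W'" "x \<in> W'" "x' \<in> W'" "A y" "E y x" "E y x'" and y2: "\<xi>' y = 2"
    show "s' x = s' x'"
    proof (rule pairA[OF y(2,3,1,4-6), where P = "\<lambda>x x'. s' x = s' x'"])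
      assume "y \<in> W" "x \<in> W" "x' \<in> W"
      then show "s' x = s' x'" using C4[of y x x'] y oldv y2 by auto
    next
      fix j assume "j < k" "y = a j"
      then show "s' (b j) = s' (b (Suc j))" using Sb[of j] Sb[of "Suc j"] La[of j] y2 ok12'[of j] by simp
    next
      fix z assume z: "y = a 0" "z \<in> W" "E (a 0) z" "z \<noteq> b 0"
      have e2: "e = 2" using z(1) y2 La[of 0] ok3 k by simp
      then have "s (b 0) = s z" using C4[OF old(1) old(2) z(2) A0(1) old(4) z(3)] by (simp add: e_def)
      then show "s' (b 1) = s' z" using oldv[OF z(2)] Sb[of 1] ok12'[of 0] ok3 ok4 e2 k by (simp add: \<sigma>_def)
    qed auto
  next
    fix y x x' assume y: "y \<in> W'" "x \<in> W'" "x' \<in> W'" "A y" "E y x" "E y x'" and y2: "\<xi>' y \<noteq> 2"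
      and x2: "\<kappa>' x \<noteq> 2" "\<kappa>' x' \<noteq> 2" "x \<noteq> x'"
    \<comment> \<open>Demanding label 2 of both \<open>a1\<close> and \<open>a2\<close> makes the
      relation symmetric, as \<open>pairA\<close> requires; for old vertices the label of
      \<open>a2\<close> follows from the shared class-2 neighbour.\<close>
    let ?Q = "\<lambda>x x'. \<exists>a1\<in>W'. \<exists>a2\<in>W'. E a1 x \<and> E a2 x' \<and> \<xi>' a1 = 2 \<and> \<xi>' a2 = 2 \<and> siblings E W' \<kappa>' a1 a2"
    let ?P = "\<lambda>x x'. \<kappa>' x \<noteq> 2 \<longrightarrow> \<kappa>' x' \<noteq> 2 \<longrightarrow> x \<noteq> x' \<longrightarrow> s' x \<noteq> s' x' \<or> ?Q x x'"
    have "?P x x'"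
    proof (rule pairA[OF y(2,3,1,4-6), where P = ?P])
      assume W: "y \<in> W" "x \<in> W" "x' \<in> W"
      show "?P x x'"
      proof (intro impI)
        assume "\<kappa>' x \<noteq> 2" "\<kappa>' x' \<noteq> 2" "x \<noteq> x'"
        then have "s x \<noteq> s x' \<or> (\<exists>a1\<in>W. \<exists>a2\<in>W. E a1 x \<and> E a2 x' \<and> \<xi> a1 = 2 \<and> siblings E W \<kappa> a1 a2)"
          using C5[of y x x'] W y y2 oldv by simp
        then show "s' x \<noteq> s' x' \<or> ?Q x x'"
        proof
          assume "\<exists>a1\<in>W. \<exists>a2\<in>W. E a1 x \<and> E a2 x' \<and> \<xi> a1 = 2 \<and> siblings E W \<kappa> a1 a2"
          then obtain a1 a2 where aa: "a1 \<in> W" "a2 \<in> W" "E a1 x" "E a2 x'" "\<xi> a1 = 2" "siblings E W \<kappa> a1 a2" by blast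
          have "\<xi> a2 = 2"
          proof (cases "a1 = a2")
            case False
            then obtain z where z: "z \<in> W" "\<kappa> z = 2" "E a1 z" "E a2 z" using aa(6) unfolding siblings_def by blast
            have "A a1" using bip[OF aa(3)] bip[OF y(5)] y(4) by simp
            then show ?thesis using C2[OF z(1) aa(1,2) _ z(3,4,2)] aa(5) by simp
          qed (use aa in simp)
          then have "?Q x x'" using aa W' oldv sib_mono by (intro bexI[of _ a1] bexI[of _ a2]) auto
          then show ?thesis by blast
        qed (use oldv W in simp)
      qed
    next
      fix j assume j: "j < k" "y = a j"
      show "?P (b j) (b (Suc j))"
      proof (intro impI)
        assume "\<kappa>' (b j) \<noteq> 2" "\<kappa>' (b (Suc j)) \<noteq> 2" "b j \<noteq> b (Suc j)"
        then have "S j \<noteq> S (Suc j) \<or> k \<le> 3 \<and> (\<forall>i<k. i \<noteq> j \<longrightarrow> L i = 2)"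
          using Kb[of j] Kb[of "Suc j"] La[of j] y2 j ok13'[of j] by simp
        then show "s' (b j) \<noteq> s' (b (Suc j)) \<or> ?Q (b j) (b (Suc j))"
          using Sb[of j] Sb[of "Suc j"] j exempt[of j] by auto
      qed
    next
      fix z assume z: "y = a 0" "z \<in> W" "E (a 0) z" "z \<noteq> b 0"
      show "?P (b 1) z"
      proof (intro impI)
        assume "\<kappa>' (b 1) \<noteq> 2" "\<kappa>' z \<noteq> 2"
        \<comment> \<open>The classes of \<open>b 0\<close>, \<open>b 1\<close> and \<open>z\<close>
          are distinct, so \<open>b 0\<close> is the one of class 2, and the last condition of
          \<open>ear_ok\<close> separates the signs of the other two.\<close>
        then have "K 1 \<noteq> 2" "k2 \<noteq> 2" using Kb[of 1] k oldv[OF z(2)] v2[OF z(2-4)] by auto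
        moreover have "K 1 < 3" "K 1 \<noteq> k2" "K 0 \<noteq> K 1" "K 0 = kv" using ok1 ok6 ok7'[of 1] ok7'[of 0] k by auto
        ultimately have "kv = 2" using k2 \<open>kv < 3\<close> by linarith
        moreover have "e \<noteq> 2" using z(1) y2 La[of 0] ok3 k by simp
        ultimately have "S 1 \<noteq> \<sigma>2" using ok14 by blast
        then show "s' (b 1) \<noteq> s' z \<or> ?Q (b 1) z" using Sb[of 1] k oldv[OF z(2)] v2[OF z(2-4)] by simp
      qed
    next
      fix x x' assume "?P x x'"
      then show "?P x' x" using sib_sym by (metis (no_types, lifting))
    qed simp
    then show "s' x \<noteq> s' x' \<or> (\<exists>a1\<in>W'. \<exists>a2\<in>W'. E a1 x \<and> E a2 x' \<and> \<xi>' a1 = 2 \<and> siblings E W' \<kappa>' a1 a2)"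
      using x2 by blast
  qed
  then show ?thesis by blast
qed

lemma good_labelling_edge:
  assumes "E x y" "A x" "\<not> A y" and irr: "\<And>z. \<not> E z z"
  shows "good_labelling E A {x, y} (\<lambda>_. 0) (\<lambda>_. 0) (\<lambda>_. True)"
  using assms unfolding good_labelling_def siblings_def by auto

text \<open>Even positions become the \<open>a j\<close> and odd ones the \<open>b j\<close>, with
  \<open>c m\<close> in the role of both \<open>b 0\<close> and \<open>b k\<close>. The attached
  path uses up one edge at each of its ends, so they have degree at most 2 in
  \<open>W1\<close>.\<close>

lemma good_labelling_path:
  fixes c :: "nat \<Rightarrow> 'a" and k :: nat
  defines "m \<equiv> 2 * k - 1"
  assumes sym: "\<And>x y. E x y \<Longrightarrow> E y x" and bip: "\<And>x y. E x y \<Longrightarrow> A x \<noteq> A y"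
    and good: "good_labelling E A W1 \<kappa> \<xi> s" and fin: "finite W" and k: "k \<ge> 2"
    and par: "\<And>t. t \<le> m \<Longrightarrow> A (c t) = even t" and inj: "inj_on c {..m}"
    and ends: "c 0 \<in> W1" "c m \<in> W1" "E (c 0) (c m)" 
    and W: "W = W1 \<union> c ` {0<..<m}" "W1 \<inter> c ` {0<..<m} = {}"
    and nb: "\<And>t x. 0 < t \<Longrightarrow> t < m \<Longrightarrow> x \<in> W \<Longrightarrow> E (c t) x \<longleftrightarrow> x = c (t - 1) \<or> x = c (Suc t)"
    and deg: "\<And>x. x \<in> W \<Longrightarrow> card {y \<in> W. E x y} \<le> 3"
  shows "\<exists>\<kappa>' \<xi>' s'. good_labelling E A W \<kappa>' \<xi>' s'"
proof -
  define a where "a = (\<lambda>j. c (2 * j))"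
  define b where "b = (\<lambda>j. if j = 0 then c m else c (2 * j - 1))"
  have m: "m > 2" using k by (simp add: m_def)
  have deg2: "card {y \<in> W1. E x y} \<le> 2" if x: "x \<in> W1" "E x (c t)" "0 < t" "t < m" for x t
  proof -
    have t: "c t \<in> W" "c t \<notin> W1" using W x by auto
    have "insert (c t) {y \<in> W1. E x y} \<subseteq> {y \<in> W. E x y}" using t x W by auto
    then have "card (insert (c t) {y \<in> W1. E x y}) \<le> card {y \<in> W. E x y}" using fin by (intro card_mono) auto
    moreover have "card (insert (c t) {y \<in> W1. E x y}) = Suc (card {y \<in> W1. E x y})" using t fin W by simp
    ultimately show ?thesis using deg[of x] x W by simp
  qed
  have interior: "c t \<in> W" if "t \<le> m" for t using that W ends by (cases "t = 0"; cases "t = m") auto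
  have img: "c ` {0<..<m} = a ` {1..<k} \<union> b ` {1..<k}"
  proof
    show "c ` {0<..<m} \<subseteq> a ` {1..<k} \<union> b ` {1..<k}"
    proof
      fix x assume "x \<in> c ` {0<..<m}"
      then obtain t where t: "x = c t" "0 < t" "t < m" by auto
      show "x \<in> a ` {1..<k} \<union> b ` {1..<k}"
      proof (cases "even t")
        case True
        then obtain j where "t = 2 * j" by blast
        then have "x = a j" "j \<in> {1..<k}" using t by (auto simp: a_def m_def)
        then show ?thesis by blast
      next
        case False
        then obtain i where "t = 2 * i + 1" by (auto elim: oddE)
        then have "x = b (Suc i)" "Suc i \<in> {1..<k}" using t by (auto simp: b_def m_def)
        then show ?thesis by blast
      qed
    qed
    show "a ` {1..<k} \<union> b ` {1..<k} \<subseteq> c ` {0<..<m}" using k by (auto simp: a_def b_def m_def)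
  qed
  show ?thesis
  proof (rule good_labelling_ear[of E A W1 \<kappa> \<xi> s k a b W, OF sym bip good _ k])
    show "finite W1" using fin W by simp
    show "A (a j)" if "j < k" for j using par[of "2 * j"] that by (simp add: a_def m_def)
    show "\<not> A (b j)" if "j \<le> k" for j 
      using par[of "2 * j - 1"] par[of m] that k by (cases "j = 0") (auto simp: b_def m_def)
    show "a 0 \<in> W1" "b 0 \<in> W1" "E (a 0) (b 0)" using ends by (auto simp: a_def b_def)
    show "b k = b 0" using k by (simp add: b_def m_def)
    show "a j \<notin> W1 \<and> b j \<notin> W1" if "1 \<le> j" "j < k" for j
      using that img W(2) by auto
    show "inj_on a {..<k}" unfolding a_def using inj by (intro inj_onI) (auto simp: m_def dest!: inj_onD)
    show "inj_on b {..<k}"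
    proof (rule inj_onI)
      fix i j assume ij: "i \<in> {..<k}" "j \<in> {..<k}" "b i = b j"
      define r where "r = (\<lambda>i. if i = 0 then m else 2 * i - 1)"
      have "c (r i) = c (r j)" "r i \<le> m" "r j \<le> m" using ij by (auto simp: b_def r_def m_def split: if_splits)
      then have "r i = r j" using inj by (auto dest: inj_onD)
      then show "i = j" using ij by (auto simp: r_def m_def split: if_splits)
    qed
    show "W = W1 \<union> a ` {1..<k} \<union> b ` {1..<k}" using W img by auto
    show "E x (b j) \<longleftrightarrow> x = a (j - 1) \<or> x = a j" if j: "1 \<le> j" "j < k" "x \<in> W" for j x
    proof -
      have "E (b j) x \<longleftrightarrow> x = c (2 * j - 1 - 1) \<or> x = c (Suc (2 * j - 1))"
        using nb[of "2 * j - 1" x] j by (simp add: b_def m_def)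
      moreover have "2 * j - 1 - 1 = 2 * (j - 1)" "Suc (2 * j - 1) = 2 * j" using j by auto
      ultimately show ?thesis using sym unfolding a_def by metis
    qed
    show "E (a j) x \<longleftrightarrow> x = b j \<or> x = b (Suc j)" if j: "1 \<le> j" "j < k" "x \<in> W" for j x
      using nb[of "2 * j" x] j by (simp add: a_def b_def m_def)
    have E1: "E (c 0) (c 1)" using nb[of 1 "c 0"] interior[of 0] m sym by simp
    have Em: "E (c m) (c (m - 1))" using nb[of "m - 1" "c m"] interior[of m] m sym by simp
    show "card {x \<in> W1. E (a 0) x} \<le> 2" using deg2[of "c 0" 1] E1 m ends by (simp add: a_def)
    have "{x \<in> W1. E x (b 0)} = {x \<in> W1. E (c m) x}" using sym by (auto simp: b_def)
    then show "card {x \<in> W1. E x (b 0)} \<le> 2" using deg2[of "c m" "m - 1"] Em m ends by simp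
  qed
qed

section \<open>Decomposition at shortest chords\<close>

text \<open>Vertices are positions on the Hamiltonian cycle. Below a shortest edge
  \<open>i j\<close> that jumps over elements of \<open>W\<close> there are only edges between
  consecutive vertices, and by non-crossing none leads out; so the vertices strictly between
  \<open>i\<close> and \<open>j\<close> form the inner part of an attached path. The hypotheses
  survive their removal because \<open>i\<close> and \<open>j\<close>, now consecutive, are
  adjacent.\<close>

lemma good_labelling_outer:
  fixes E :: "nat \<Rightarrow> nat \<Rightarrow> bool"
  assumes sym: "\<And>x y. E x y \<Longrightarrow> E y x" and bip: "\<And>x y. E x y \<Longrightarrow> A x \<noteq> A y"
    and "finite W" "card W \<ge> 2"
    and "\<And>x. x \<in> W \<Longrightarrow> card {y \<in> W. E x y} \<le> 3"
    and "\<And>i j k l. i \<in> W \<Longrightarrow> j \<in> W \<Longrightarrow> k \<in> W \<Longrightarrow> l \<in> W \<Longrightarrow> i < k \<Longrightarrow> k < j \<Longrightarrow> j < l \<Longrightarrow> E i j \<Longrightarrow> \<not> E k l"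
    and "\<And>x y. x \<in> W \<Longrightarrow> y \<in> W \<Longrightarrow> x < y \<Longrightarrow> (\<And>z. z \<in> W \<Longrightarrow> z \<le> x \<or> y \<le> z) \<Longrightarrow> E x y"
    and "E (Min W) (Max W)"
  shows "\<exists>\<kappa> \<xi> s. good_labelling E A W \<kappa> \<xi> s"
  using assms(3-)
proof (induction "card W" arbitrary: W rule: less_induct)
  case less
  note fin = less.prems(1) and card2 = less.prems(2) and deg = less.prems(3) and nc = less.prems(4)
    and step = less.prems(5) and wrap = less.prems(6)
  have irr: "\<not> E z z" for z using bip by blast
  have ne: "W \<noteq> {}" using card2 by auto
  have MM: "Min W \<in> W" "Max W \<in> W" "\<And>z. z \<in> W \<Longrightarrow> Min W \<le> z \<and> z \<le> Max W" using fin ne by auto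
  show ?case
  proof (cases "card W = 2")
    case True
    then obtain x y where xy: "W = {x, y}" "x \<noteq> y" by (auto simp: card_2_iff)
    have "E x y"
    proof (cases "x < y")
      case True
      then show ?thesis using wrap xy by (simp add: min_def max_def)
    next
      case False
      then show ?thesis using wrap xy sym by (simp add: min_def max_def split: if_splits)
    qed
    then show ?thesis
      using good_labelling_edge[of E x y A] good_labelling_edge[of E y x A] sym bip irr xy by (metis insert_commute)
  next
    case False
    define P where "P = {(i, j). i \<in> W \<and> j \<in> W \<and> E i j \<and> (\<exists>z\<in>W. i < z \<and> z < j)}"
    have "\<not> W \<subseteq> {Min W, Max W}"
    proof
      assume "W \<subseteq> {Min W, Max W}"
      then have "card W \<le> card {Min W, Max W}" by (intro card_mono) auto
      also have "\<dots> \<le> 2" by (simp add: card_insert_if)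
      finally show False using False card2 by simp
    qed
    then obtain z where "z \<in> W" "z \<noteq> Min W" "z \<noteq> Max W" by blast
    then have z: "z \<in> W" "Min W < z" "z < Max W" using MM(3)[of z] by auto
    \<comment> \<open>The closing edge itself jumps over \<open>z\<close>, so there is an edge to
      minimise over.\<close>
    have "(Min W, Max W) \<in> P" unfolding P_def using MM(1,2) wrap z by blast
    then obtain ij where ij: "ij \<in> P" "\<And>q. q \<in> P \<Longrightarrow> snd ij - fst ij \<le> snd q - fst q"
      using exists_least_iff[of "\<lambda>d. \<exists>q\<in>P. d = snd q - fst q"] by (metis not_less)
    define i j where "i = fst ij" and "j = snd ij"
    have i: "i \<in> W" "j \<in> W" "E i j" "\<exists>z\<in>W. i < z \<and> z < j" using ij(1) by (auto simp: P_def i_def j_def)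
    have least: "j - i \<le> y - x" if "x \<in> W" "y \<in> W" "E x y" "z \<in> W" "x < z" "z < y" for x y z
      using ij(2)[of "(x, y)"] that by (auto simp: P_def i_def j_def)
    define M where "M = {z \<in> W. i < z \<and> z < j}"
    define W1 where "W1 = W - M"
    have W1: "i \<in> W1" "j \<in> W1" "W1 \<subseteq> W" "finite W1" "M \<noteq> {}" "M \<subseteq> W" "i < j" 
      using i fin by (auto simp: W1_def M_def)
    have M_out: "x \<le> i \<or> j \<le> x" if "x \<in> W1" for x using that by (auto simp: W1_def M_def)
    have h1: "card W1 < card W" using W1 fin by (intro psubset_card_mono) (auto simp: W1_def)
    have h2: "card W1 \<ge> 2"
      using card_mono[of W1 "{i, j}"] W1 by auto
    have h3: "card {y \<in> W1. E x y} \<le> 3" if "x \<in> W1" for x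
      using card_mono[of "{y \<in> W. E x y}" "{y \<in> W1. E x y}"] deg[of x] that W1 fin by force
    have h4: "E x y" if xy: "x \<in> W1" "y \<in> W1" "x < y" "\<And>z. z \<in> W1 \<Longrightarrow> z \<le> x \<or> y \<le> z" for x y
    proof (cases "\<exists>z\<in>M. x < z \<and> z < y")
      case True
      then obtain z where z: "z \<in> M" "x < z" "z < y" by blast
      then have "x \<le> i" "j \<le> y" using M_out[OF xy(1)] M_out[OF xy(2)] by (auto simp: M_def)
      then have "x = i" "y = j" using xy(4)[OF W1(1)] xy(4)[OF W1(2)] W1(7) by auto
      then show ?thesis using i by simp
    next
      case False
      show ?thesis
      proof (rule step)
        fix z assume "z \<in> W"
        then show "z \<le> x \<or> y \<le> z" using False xy(4)[of z] unfolding W1_def by (meson DiffI not_le)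
      qed (use xy W1 in auto)
    qed
    have h5: "E (Min W1) (Max W1)"
    proof -
      have "Min W \<in> W1" "Max W \<in> W1" using MM i by (force simp: W1_def M_def)+
      then have "Min W1 = Min W" "Max W1 = Max W" 
        using MM W1 by (auto intro!: Min_eqI Max_eqI)
      then show ?thesis using wrap by simp
    qed
    have "\<exists>\<kappa> \<xi> s. good_labelling E A W1 \<kappa> \<xi> s"
    proof (rule less.hyps[OF h1 W1(4) h2])
      show "\<not> E k l" if "p \<in> W1" "q \<in> W1" "k \<in> W1" "l \<in> W1" "p < k" "k < q" "q < l" "E p q" for p q k l
        using nc[of p q k l] that W1(3) by blast
      show "E x y" if "x \<in> W1" "y \<in> W1" "x < y" "\<And>z. z \<in> W1 \<Longrightarrow> z \<le> x \<or> y \<le> z" for x y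
        by (rule h4[OF that])
    qed (fact h3 h5)+
    then obtain \<kappa> \<xi> s where good: "good_labelling E A W1 \<kappa> \<xi> s" by blast
    define cs where "cs = sorted_list_of_set {z \<in> W. i \<le> z \<and> z \<le> j}"
    define m where "m = length cs - 1"
    have cs: "set cs = {z \<in> W. i \<le> z \<and> z \<le> j}" "sorted cs" "distinct cs" 
      using fin by (auto simp: cs_def)
    have card_cs: "length cs \<ge> 3"
    proof -
      obtain z where z: "z \<in> W" "i < z" "z < j" using i by blast
      have "card {i, z, j} \<le> card (set cs)" using z i W1(7) unfolding cs by (intro card_mono) (auto simp: fin)
      then show ?thesis using z cs(3) by (simp add: distinct_card)
    qed
    have len: "length cs = Suc m" "m \<ge> 2" using card_cs by (auto simp: m_def)
    have mono: "cs ! p < cs ! q \<longleftrightarrow> p < q" if "p \<le> m" "q \<le> m" for p q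
    proof -
      have "sorted_wrt (<) cs" using cs by (simp add: strict_sorted_iff)
      then have *: "\<And>p q. p < q \<Longrightarrow> q \<le> m \<Longrightarrow> cs ! p < cs ! q" using len by (simp add: sorted_wrt_nth_less)
      show ?thesis using *[of p q] *[of q p] that by (metis less_asym nat_neq_iff less_irrefl)
    qed
    have mem: "cs ! t \<in> W" "i \<le> cs ! t" "cs ! t \<le> j" if "t \<le> m" for t
      using nth_mem[of t cs] that len unfolding cs by auto
    have ex: "\<exists>t\<le>m. x = cs ! t" if "x \<in> W" "i \<le> x" "x \<le> j" for x
    proof -
      have "x \<in> set cs" using that by (simp add: cs)
      then show ?thesis using len by (auto simp: in_set_conv_nth less_Suc_eq_le)
    qed
    have c0: "cs ! 0 = i"
    proof -
      obtain t where t: "t \<le> m" "i = cs ! t" using ex[of i] i W1(7) by auto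
      then show ?thesis using mem(2)[of 0] mono[of 0 t] by (cases "t = 0") auto
    qed
    have cm: "cs ! m = j"
    proof -
      obtain t where t: "t \<le> m" "j = cs ! t" using ex[of j] i W1(7) by auto
      then show ?thesis using mem(3)[of m] mono[of t m] by (cases "t = m") auto
    qed
    have sub: "cs ! t \<noteq> cs ! r" if "t \<le> m" "r \<le> m" "t \<noteq> r" for t r
      using mono[of t r] mono[of r t] that by linarith
    have inner: "cs ! t \<in> M" if "0 < t" "t < m" for t
      using mem[of t] mono[of 0 t] mono[of t m] that c0 cm by (auto simp: M_def)
    have suc: "E (cs ! t) (cs ! Suc t)" if t: "t < m" for t
    proof (rule step)
      fix z assume z: "z \<in> W"
      show "z \<le> cs ! t \<or> cs ! Suc t \<le> z"
      proof (cases "i \<le> z \<and> z \<le> j")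
        case True
        then obtain r where r: "r \<le> m" "z = cs ! r" using ex z by blast
        consider "r < t" | "r = t" | "r = Suc t" | "Suc t < r" by linarith
        then show ?thesis using mono[of r t] mono[of "Suc t" r] t r by cases auto
      next
        case False
        then show ?thesis using mem[of t] mem[of "Suc t"] t by auto
      qed
    qed (use mem mono t in auto)
    have nbr: "x = cs ! (t - 1) \<or> x = cs ! Suc t" if t: "0 < t" "t < m" and x: "x \<in> W" "E (cs ! t) x" for t x
    proof -
      have "i < cs ! t" "cs ! t < j" "cs ! t \<in> W" using inner[OF t] by (auto simp: M_def)
      have "\<not> x < i" using nc[of x "cs ! t" i j] x i sym \<open>i < cs ! t\<close> \<open>cs ! t < j\<close> \<open>cs ! t \<in> W\<close> by blast
      moreover have "\<not> j < x" using nc[of i j "cs ! t" x] x i \<open>i < cs ! t\<close> \<open>cs ! t < j\<close> \<open>cs ! t \<in> W\<close> by blast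
      ultimately obtain r where r: "r \<le> m" "x = cs ! r" using ex[of x] x by auto
      have "r \<noteq> t" using x r irr by metis
      have "\<not> Suc t < r"
      proof
        assume "Suc t < r"
        then have "j - i \<le> x - cs ! t" 
          using least[of "cs ! t" x "cs ! Suc t"] x r mem[of t] mem[of "Suc t"] mono[of t "Suc t"] mono[of "Suc t" r] by simp
        moreover have "x \<le> j" using r mem by simp
        ultimately show False using \<open>i < cs ! t\<close> \<open>cs ! t < j\<close> by linarith
      qed
      moreover have "\<not> r < t - 1"
      proof
        assume r1: "r < t - 1"
        then have "j - i \<le> cs ! t - x" 
          using least[of x "cs ! t" "cs ! (t - 1)"] x r t mem[of t] mem[of "t - 1"] mono[of "t - 1" t] mono[of r "t - 1"] sym by simp
        moreover have "i \<le> x" "x < cs ! t" using r mem r1 mono[of r t] t by auto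
        ultimately show False using \<open>i < cs ! t\<close> \<open>cs ! t < j\<close> by linarith
      qed
      ultimately have "r = t - 1 \<or> r = Suc t" using \<open>r \<noteq> t\<close> by linarith
      then show ?thesis using r by blast
    qed
    have M_cs: "M = (!) cs ` {0<..<m}"
    proof
      show "M \<subseteq> (!) cs ` {0<..<m}"
      proof
        fix x assume x: "x \<in> M"
        then obtain t where t: "t \<le> m" "x = cs ! t" using ex[of x] by (auto simp: M_def)
        have "i < x" "x < j" using x by (auto simp: M_def)
        then have "t \<noteq> 0" "t \<noteq> m" using c0 cm t(2) by (metis less_irrefl)+
        then show "x \<in> (!) cs ` {0<..<m}" using t by (intro image_eqI[of _ _ t]) auto
      qed
    qed (use inner in auto)
    have par: "A (cs ! t) = (A i \<noteq> odd t)" if "t \<le> m" for t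
      using that
    proof (induction t)
      case (Suc t)
      then show ?case using bip[OF suc[of t]] by auto
    qed (use c0 in simp)
    have "odd m" using par[of m] cm bip[OF i(3)] by auto
    then obtain k where k: "m = 2 * k - 1" "k \<ge> 2"
    proof -
      obtain q where q: "m = 2 * q + 1" using \<open>odd m\<close> by (auto elim: oddE)
      show ?thesis by (rule that[of "Suc q"]) (use q len(2) in auto)
    qed
    have WM: "W = W1 \<union> M" "W1 \<inter> M = {}" using W1 by (auto simp: W1_def)
    show ?thesis
    proof (cases "A i")
      case True
      show ?thesis
      proof (rule good_labelling_path[of E A W1 \<kappa> \<xi> s W k "(!) cs", OF sym bip good fin k(2)])
        show "A (cs ! t) = even t" if "t \<le> 2 * k - 1" for t using par[of t] that True k by simp
        show "inj_on ((!) cs) {..2 * k - 1}" using sub k by (intro inj_onI) auto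
        show "E (cs ! t) x = (x = cs ! (t - 1) \<or> x = cs ! Suc t)" if "0 < t" "t < 2 * k - 1" "x \<in> W" for t x
          using nbr[of t x] suc[of t] suc[of "t - 1"] that k sym by auto
      qed (use WM M_cs c0 cm W1 i k deg in auto)
    next
      case False
      \<comment> \<open>Reversing the path makes it start in \<open>A\<close>: as \<open>m\<close>
        is odd, exactly one of \<open>i\<close> and \<open>j\<close> is in \<open>A\<close>.\<close>
      define c where "c = (\<lambda>t. cs ! (m - t))"
      have img: "c ` {0<..<m} = M"
      proof -
        have "(\<lambda>t. m - t) ` {0<..<m} = {0<..<m}"
        proof
          show "{0<..<m} \<subseteq> (\<lambda>t. m - t) ` {0<..<m}"
          proof
            fix t assume "t \<in> {0<..<m}"
            then show "t \<in> (\<lambda>t. m - t) ` {0<..<m}" by (intro image_eqI[of _ _ "m - t"]) auto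
          qed
        qed auto
        then show ?thesis unfolding M_cs c_def by (metis image_image)
      qed
      show ?thesis
      proof (rule good_labelling_path[of E A W1 \<kappa> \<xi> s W k c, OF sym bip good fin k(2)])
        show "A (c t) = even t" if "t \<le> 2 * k - 1" for t 
        proof -
          have "t \<le> m" using that k(1) by simp
          then have "odd (m - t) = even t" using \<open>odd m\<close> by (auto simp: even_diff_nat not_less)
          then show ?thesis using par[of "m - t"] False by (simp add: c_def)
        qed
        show "inj_on c {..2 * k - 1}" using sub k unfolding c_def by (intro inj_onI) (metis atMost_iff diff_diff_cancel diff_le_self)
        show "E (c t) x = (x = c (t - 1) \<or> x = c (Suc t))" if t: "0 < t" "t < 2 * k - 1" "x \<in> W" for t x
        proof -
          have e: "m - (t - 1) = Suc (m - t)" "m - Suc t = m - t - 1" "0 < m - t" "m - t < m" using t k by auto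
          have "Suc (m - t - 1) = m - t" "m - t - 1 < m" using t k by auto
          then have "E (cs ! (m - t - 1)) (cs ! (m - t))" using suc[of "m - t - 1"] by metis
          moreover have "E (cs ! (m - t)) (cs ! Suc (m - t))" using suc[of "m - t"] e(4) by blast
          ultimately show ?thesis using nbr[of "m - t" x] e t sym unfolding c_def by metis
        qed
        show "W = W1 \<union> c ` {0<..<2 * k - 1}" "W1 \<inter> c ` {0<..<2 * k - 1} = {}" using WM img k by auto
        show "c 0 \<in> W1" "c (2 * k - 1) \<in> W1" "E (c 0) (c (2 * k - 1))"
          using c0 cm k W1 i sym by (auto simp: c_def)
      qed (use deg in auto)
    qed
  qed
qed

section \<open>The packing colouring\<close>

lemma good_labelling_nth:
  assumes "good_labelling (\<lambda>i j. E (xs ! i) (xs ! j)) (\<lambda>i. A (xs ! i)) {..<length xs} \<kappa> \<xi> s" "distinct xs"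
  shows "\<exists>\<kappa>' \<xi>' s'. good_labelling E A (set xs) \<kappa>' \<xi>' s'"
proof -
  define f where "f = inv_into {..<length xs} ((!) xs)"
  let ?E = "\<lambda>i j. E (xs ! i) (xs ! j)" and ?I = "{..<length xs}"
  have f: "f (xs ! i) = i" if "i \<in> ?I" for i
    unfolding f_def using that assms(2) by (intro inv_into_f_f) (auto simp: inj_on_def nth_eq_iff_index_eq)
  have g: "f x \<in> ?I" "xs ! f x = x" if "x \<in> set xs" for x
    using that f by (auto simp: in_set_conv_nth)
  have sib: "siblings E (set xs) (\<lambda>x. \<kappa> (f x)) x y" if "siblings ?E ?I \<kappa> (f x) (f y)" "x \<in> set xs" "y \<in> set xs" for x y
  proof (cases "x = y")
    case False
    then have "f x \<noteq> f y" using g(2) that(2,3) by metis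
    with that(1) have "\<exists>i\<in>?I. \<kappa> i = 2 \<and> ?E (f x) i \<and> ?E (f y) i" unfolding siblings_def by (simp only: simp_thms)
    then obtain i where i: "i \<in> ?I" "\<kappa> i = 2" "?E (f x) i" "?E (f y) i" by (elim bexE conjE)
    then have "xs ! i \<in> set xs" "\<kappa> (f (xs ! i)) = 2" "E x (xs ! i)" "E y (xs ! i)" 
      using f[OF i(1)] g(2)[OF that(2)] g(2)[OF that(3)] by simp_all
    then show ?thesis unfolding siblings_def by blast
  qed (simp add: siblings_def)
  note g1 = assms(1)[unfolded good_labelling_def]
  note g2 = conjunct2[OF g1]
  note g3 = conjunct2[OF g2]
  note g4 = conjunct2[OF g3]
  note g5 = conjunct2[OF g4]
  note g6 = conjunct2[OF g5]
  note g7 = conjunct2[OF g6]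
  have "good_labelling E A (set xs) (\<lambda>x. \<kappa> (f x)) (\<lambda>x. \<xi> (f x)) (\<lambda>x. s (f x))"
    unfolding good_labelling_def
  proof (intro conjI ballI impI)
    show "\<kappa> (f b) < 3" if "b \<in> set xs" "\<not> A b" for b
      using conjunct1[OF g1, rule_format, of "f b"] g[of b] that by simp
    show "\<xi> (f a) < 3" if "a \<in> set xs" "A a" for a
      using conjunct1[OF g2, rule_format, of "f a"] g[of a] that by simp
    show "b = b'" if "a \<in> set xs" "b \<in> set xs" "b' \<in> set xs" "A a" "E a b" "E a b'" "\<kappa> (f b) = \<kappa> (f b')" for a b b'
      using conjunct1[OF g3, rule_format, of "f a" "f b" "f b'"] g[of a] g[of b] g[of b'] that by metis
    show "\<xi> (f a) = \<xi> (f a')" if "b \<in> set xs" "a \<in> set xs" "a' \<in> set xs" "A a" "E a b" "E a' b" "\<kappa> (f b) = 2" for a a' b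
      using conjunct1[OF g4, rule_format, of "f b" "f a" "f a'"] g[of a] g[of b] g[of a'] that by simp
    show "siblings E (set xs) (\<lambda>x. \<kappa> (f x)) a a'" if "b \<in> set xs" "a \<in> set xs" "a' \<in> set xs" "A a" "E a b" "E a' b" "\<kappa> (f b) \<noteq> 2" 
      "\<xi> (f a) = \<xi> (f a')" for a a' b
      using conjunct1[OF g5, rule_format, of "f b" "f a" "f a'"] g[of a] g[of b] g[of a'] that sib[of a a'] by simp
    show "s (f b) = s (f b')" if "a \<in> set xs" "b \<in> set xs" "b' \<in> set xs" "A a" "E a b" "E a b'" "\<xi> (f a) = 2" for a b b'
      using conjunct1[OF g6, rule_format, of "f a" "f b" "f b'"] g[of a] g[of b] g[of b'] that by simp
    fix a b b' assume ab: "a \<in> set xs" "b \<in> set xs" "b' \<in> set xs" "A a" "E a b" "E a b'" "\<xi> (f a) \<noteq> 2" 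
      "\<kappa> (f b) \<noteq> 2" "\<kappa> (f b') \<noteq> 2" "b \<noteq> b'"
    then have "f b \<noteq> f b'" using g(2) by metis
    then have "s (f b) \<noteq> s (f b') \<or> (\<exists>a1\<in>?I. \<exists>a2\<in>?I. ?E a1 (f b) \<and> ?E a2 (f b') \<and> \<xi> a1 = 2 \<and> siblings ?E ?I \<kappa> a1 a2)"
      using g7[rule_format, of "f a" "f b" "f b'"] g[of a] g[of b] g[of b'] ab by simp
    then show "s (f b) \<noteq> s (f b') \<or> (\<exists>a1\<in>set xs. \<exists>a2\<in>set xs. E a1 b \<and> E a2 b' \<and> \<xi> (f a1) = 2 \<and> 
      siblings E (set xs) (\<lambda>x. \<kappa> (f x)) a1 a2)"
    proof
      assume "\<exists>a1\<in>?I. \<exists>a2\<in>?I. ?E a1 (f b) \<and> ?E a2 (f b') \<and> \<xi> a1 = 2 \<and> siblings ?E ?I \<kappa> a1 a2"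
      then obtain i j where ij: "i \<in> ?I" "j \<in> ?I" "?E i (f b)" "?E j (f b')" "\<xi> i = 2" "siblings ?E ?I \<kappa> i j" by blast
      have "xs ! i \<in> set xs" "xs ! j \<in> set xs" using ij(1,2) by auto
      moreover have "siblings E (set xs) (\<lambda>x. \<kappa> (f x)) (xs ! i) (xs ! j)" using sib[of "xs ! i" "xs ! j"] f[OF ij(1)] f[OF ij(2)] ij(6) calculation by simp
      moreover have "\<xi> (f (xs ! i)) = 2" using f[OF ij(1)] ij(5) by simp
      moreover have "E (xs ! i) b" "E (xs ! j) b'" using ij(3,4) g(2)[OF ab(2)] g(2)[OF ab(3)] by simp_all
      ultimately show ?thesis by blast
    qed blast
  qed
  then show ?thesis by blast
qed

text \<open>In a good labelling all neighbours of a class-2 vertex have the same label, so any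
  choice of \<open>a\<close> gives the same colour.\<close>

definition packing_color ::
    "('a \<Rightarrow> 'a \<Rightarrow> bool) \<Rightarrow> ('a \<Rightarrow> bool) \<Rightarrow> ('a \<Rightarrow> nat) \<Rightarrow> ('a \<Rightarrow> nat) \<Rightarrow> ('a \<Rightarrow> bool) \<Rightarrow> 'a \<Rightarrow> nat" where
  "packing_color E A \<kappa> \<xi> s v =
     (if A v then 1 else if \<kappa> v = 0 then 2 else if \<kappa> v = 1 then 3
      else let l = \<xi> (SOME a. E a v) in if l = 0 then 4 else if l = 1 then 5 else if s v then 6 else 7)"

lemma relpow_parity:
  fixes A :: "'a \<Rightarrow> bool"
  assumes "\<And>x y. (x, y) \<in> R \<Longrightarrow> A x \<noteq> A y" "(u, v) \<in> R ^^ n"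
  shows "(A u = A v) = even n"
  using assms(2)
proof (induction n arbitrary: v)
  case (Suc n)
  then obtain w where "(u, w) \<in> R ^^ n" "(w, v) \<in> R" by auto
  then have "(A u = A w) = even n" "A w \<noteq> A v" using Suc.IH[of w] assms(1)[of w v] by auto
  then show ?case by (cases "A u"; cases "A w"; cases "A v") simp_all
qed simp

text \<open>Equally coloured vertices are on the same side, so \<open>n\<close> is even, and small
  even values are excluded one by one: \<open>n \<ge> 4\<close> suffices for the colours 2 and 3,
  \<open>n \<ge> 6\<close> for 4 and 5, \<open>n \<ge> 8\<close> for 6 and 7.\<close>

lemma packing_color_far:
  assumes EV: "\<And>x y. E x y \<Longrightarrow> x \<in> V \<and> y \<in> V" and sym: "\<And>x y. E x y \<Longrightarrow> E y x" 
    and bip: "\<And>x y. E x y \<Longrightarrow> A x \<noteq> A y" and good: "good_labelling E A V \<kappa> \<xi> s"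
    and uv: "u \<in> V" "v \<in> V" "u \<noteq> v" "packing_color E A \<kappa> \<xi> s u = packing_color E A \<kappa> \<xi> s v"
    and walk: "(u, v) \<in> {(x, y). E x y} ^^ n"
  shows "n > packing_color E A \<kappa> \<xi> s u"
proof -
  let ?R = "{(x, y). E x y}" and ?c = "packing_color E A \<kappa> \<xi> s"
  note g1 = good[unfolded good_labelling_def]
  note g2 = conjunct2[OF g1]
  note g3 = conjunct2[OF g2]
  note g4 = conjunct2[OF g3]
  note g5 = conjunct2[OF g4]
  note g6 = conjunct2[OF g5]
  note g7 = conjunct2[OF g6]
  have rng: "\<And>x. x \<in> V \<Longrightarrow> \<not> A x \<Longrightarrow> \<kappa> x < 3" "\<And>y. y \<in> V \<Longrightarrow> A y \<Longrightarrow> \<xi> y < 3" 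
    using conjunct1[OF g1] conjunct1[OF g2] by blast+
  have C1: "\<And>y x x'. A y \<Longrightarrow> E y x \<Longrightarrow> E y x' \<Longrightarrow> \<kappa> x = \<kappa> x' \<Longrightarrow> x = x'"
    using conjunct1[OF g3] EV by blast
  have C2: "\<And>x y y'. A y \<Longrightarrow> E y x \<Longrightarrow> E y' x \<Longrightarrow> \<kappa> x = 2 \<Longrightarrow> \<xi> y = \<xi> y'"
    using conjunct1[OF g4] EV by blast
  have C3: "\<And>x y y'. A y \<Longrightarrow> E y x \<Longrightarrow> E y' x \<Longrightarrow> \<kappa> x \<noteq> 2 \<Longrightarrow> \<xi> y = \<xi> y' \<Longrightarrow> siblings E V \<kappa> y y'"
    using conjunct1[OF g5] EV by blast
  have C4: "\<And>y x x'. A y \<Longrightarrow> E y x \<Longrightarrow> E y x' \<Longrightarrow> \<xi> y = 2 \<Longrightarrow> s x = s x'"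
    using conjunct1[OF g6] EV by blast
  have C5: "\<And>y x x'. A y \<Longrightarrow> E y x \<Longrightarrow> E y x' \<Longrightarrow> \<xi> y \<noteq> 2 \<Longrightarrow> \<kappa> x \<noteq> 2 \<Longrightarrow> \<kappa> x' \<noteq> 2 \<Longrightarrow> x \<noteq> x' \<Longrightarrow>
    s x \<noteq> s x' \<or> (\<exists>a1\<in>V. \<exists>a2\<in>V. E a1 x \<and> E a2 x' \<and> \<xi> a1 = 2 \<and> siblings E V \<kappa> a1 a2)"
    using g7 EV by blast
  \<comment> \<open>An \<open>A\<close>-vertex has at most one neighbour in class 2, so siblings share it.\<close>
  have sib: "E a' x" if "siblings E V \<kappa> a a'" "A a" "E a x" "\<kappa> x = 2" for a a' x
    using that C1 unfolding siblings_def by metis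
  have n0: "n \<noteq> 0" using walk uv(3) by (intro notI) simp
  have A_eq: "A u = A v" using uv(4) unfolding packing_color_def Let_def by (auto split: if_splits)
  have even: "even n" using relpow_parity[OF _ walk, of A] bip A_eq by auto
  show ?thesis
  proof (cases "A u")
    case True
    then have "?c u = 1" by (simp add: packing_color_def)
    moreover have "n \<noteq> 1" using even by auto
    ultimately show ?thesis using n0 by simp
  next
    case False
    then have nA: "\<not> A u" "\<not> A v" using A_eq by auto
    have k3: "\<kappa> u < 3" "\<kappa> v < 3" using rng nA uv by auto
    have \<kappa>_eq: "\<kappa> u = \<kappa> v" using uv(4) nA k3 unfolding packing_color_def Let_def by (auto split: if_splits)
    have step: "\<exists>w. E x w \<and> (w, z) \<in> ?R ^^ m" if "(x, z) \<in> ?R ^^ Suc m" for x z m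
      using relpow_Suc_D2[OF that] by auto
    have step2: "\<exists>w y. E x w \<and> E w y \<and> (y, z) \<in> ?R ^^ m" if "(x, z) \<in> ?R ^^ Suc (Suc m)" for x z m
      using step[OF that] step by blast
    have zero: "y = z" if "(y, z) \<in> ?R ^^ 0" for y z using that by simp
    have n2: "n \<noteq> 2"
    proof
      assume "n = 2"
      then have "(u, v) \<in> ?R ^^ Suc (Suc 0)" using walk by (simp only: numeral_2_eq_2)
      from step2[OF this] obtain a where a: "E u a" "E a v" using zero by blast
      have "A a" using bip[OF a(1)] nA by blast
      then show False using C1[OF _ sym[OF a(1)] a(2) \<kappa>_eq] uv(3) by blast
    qed
    then have n4: "n \<ge> 4" using n0 even by presburger
    show ?thesis
    proof (cases "\<kappa> u = 2")
      case False
      then have "?c u \<le> 3" using nA k3 by (auto simp: packing_color_def)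
      then show ?thesis using n4 by simp
    next
      case True
      then have X: "\<kappa> u = 2" "\<kappa> v = 2" using \<kappa>_eq by auto
      have Aa: "A a" if "E a u \<or> E a v" for a using that bip[of a] nA by auto
      have lab: "\<xi> a = \<xi> (SOME a. E a x)" if "\<kappa> x = 2" "\<not> A x" "E a x" for a x
        by (rule C2[OF _ that(3) someI[of "\<lambda>a. E a x", OF that(3)] that(1)]) (use bip[OF that(3)] that(2) in auto)
      \<comment> \<open>If \<open>y\<close> has class 2, it equals both \<open>u\<close> and
        \<open>v\<close>. Otherwise \<open>a\<close> and \<open>a'\<close> are siblings, so
        \<open>a'\<close> is adjacent to \<open>u\<close> as well as to \<open>v\<close>, two
        vertices of class 2.\<close>
      have no4: False if w: "E a u" "E a y" "E a' y" "E a' v" "\<xi> a = \<xi> a'" for a a' y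
      proof (cases "\<kappa> y = 2")
        case True
        then have "y = u" using C1[OF Aa w(2,1)] w X by simp
        then show False using C1[OF Aa w(3,4)] w X uv(3) by simp
      next
        case False
        have "E a' u" using sib[OF C3[OF Aa w(2,3) False w(5)] Aa] w X by blast
        then show False using C1[OF Aa _ w(4)] w X uv(3) by metis
      qed
      obtain n' where n': "n = Suc n'" using n0 by (cases n) auto
      obtain a0 where a0: "E u a0" using step[of u v n'] walk n' by blast
      obtain a1 where a1: "E a1 v" using walk unfolding n' by (auto elim: relpow_Suc_E)
      have \<xi>_eq: "\<xi> a = \<xi> a'" if "E a u" "E a' v" for a a'
      proof -
        have e: "\<xi> a = \<xi> (SOME a. E a u)" "\<xi> a' = \<xi> (SOME a. E a v)" using lab that X nA by blast+
        have "\<xi> a < 3" "\<xi> a' < 3" using rng(2) EV that Aa by blast+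
        then show ?thesis using uv(4) X nA e unfolding packing_color_def Let_def by (auto split: if_splits)
      qed
      have "n \<noteq> 4"
      proof
        assume "n = 4"
        moreover have "4 = Suc (Suc (Suc (Suc 0)))" by simp
        ultimately have "(u, v) \<in> ?R ^^ Suc (Suc (Suc (Suc 0)))" using walk by (simp only:)
        from step2[OF this] obtain a y where ay: "E u a" "E a y" "(y, v) \<in> ?R ^^ Suc (Suc 0)" by blast
        from step2[OF ay(3)] obtain a' where a': "E y a'" "E a' v" using zero by blast
        show False using no4[OF sym[OF ay(1)] ay(2) sym[OF a'(1)] a'(2)] \<xi>_eq[OF sym[OF ay(1)] a'(2)] by blast
      qed
      then have n6: "n \<ge> 6" using n4 even by presburger
      show ?thesis
      proof (cases "\<xi> a0 = 2")
        case False
        have "\<xi> a0 < 3" using rng(2) EV a0 sym Aa by blast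
        moreover have "\<xi> a0 = \<xi> (SOME a. E a u)" using lab[OF X(1) nA(1) sym[OF a0]] .
        ultimately have "?c u \<le> 5" using False X nA by (auto simp: packing_color_def Let_def)
        then show ?thesis using n6 by simp
      next
        case True
        have \<xi>2: "\<xi> a = 2" if "E a u \<or> E a v" for a
          using \<xi>_eq[OF sym[OF a0] a1] \<xi>_eq[OF _ a1, of a] \<xi>_eq[OF sym[OF a0], of a] that True by auto
        have suv: "s u = s v"
          using uv(4) X nA lab[OF X(1) nA(1) sym[OF a0]] lab[OF X(2) nA(2) a1] True \<xi>2[of a1] a1
          by (auto simp: packing_color_def Let_def split: if_splits)
        have "n \<noteq> 6"
        proof
          assume "n = 6"
          moreover have "6 = Suc (Suc (Suc (Suc (Suc (Suc 0)))))" by simp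
          ultimately have "(u, v) \<in> ?R ^^ Suc (Suc (Suc (Suc (Suc (Suc 0)))))" using walk by (simp only:)
          from step2[OF this] obtain a y where ay: "E u a" "E a y" "(y, v) \<in> ?R ^^ Suc (Suc (Suc (Suc 0)))" by blast
          from step2[OF ay(3)] obtain b z where bz: "E y b" "E b z" "(z, v) \<in> ?R ^^ Suc (Suc 0)" by blast
          from step2[OF bz(3)] obtain a' where "E z a'" "E a' v" using zero by blast
          note w = ay(1,2) bz(1,2) this
          have w': "E a u" "E b y" "E a' z" by (rule sym, fact w)+
          have nA2: "\<not> A y" "\<not> A z" using bip[OF w(1)] bip[OF w(2)] bip[OF w(5)] bip[OF w(6)] nA by auto
          have Ab: "A a" "A b" "A a'" using bip[OF w(1)] bip[OF w(3)] bip[OF w(6)] nA nA2 by auto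
          have l: "\<xi> a = 2" "\<xi> a' = 2" using \<xi>2 w w' by blast+
          have yz: "y \<noteq> z" using no4[of a y a'] w w' l by auto
          have ky: "\<kappa> y \<noteq> 2"
          proof
            assume "\<kappa> y = 2"
            then have "y = u" using C1[OF Ab(1) w(2) w'(1)] X by simp
            then show False using no4[of b z a'] w w' \<xi>2[of b] l by auto
          qed
          have kz: "\<kappa> z \<noteq> 2"
          proof
            assume "\<kappa> z = 2"
            then have "z = v" using C1[OF Ab(3) w'(3) w(6)] X by simp
            then show False using no4[of a y b] w w' \<xi>2[of b] l by auto
          qed
          \<comment> \<open>Both \<open>a\<close> and \<open>a'\<close> have label 2 and keep the
            sign, so the equal signs of \<open>u\<close> and \<open>v\<close> pass on to
            \<open>y\<close> and \<open>z\<close>.\<close>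
          have sy: "s y = s z" 
            using C4[OF Ab(1) w(2) w'(1) l(1)] C4[OF Ab(3) w'(3) w(6) l(2)] suv by simp
          \<comment> \<open>Neighbours of \<open>y\<close> with label 2 are siblings of
            \<open>a\<close> and hence adjacent to its class-2 neighbour \<open>u\<close>.\<close>
          have shared: "E a1 u" if "E a1 y" "\<xi> a1 = 2" for a1
            by (rule sib[OF C3[OF Ab(1) w(2) that(1) ky] Ab(1) w'(1) X(1)]) (use l that in simp)
          have shared': "E a1 v" if "E a1 z" "\<xi> a1 = 2" for a1
            by (rule sib[OF C3[OF Ab(3) w'(3) that(1) kz] Ab(3) w(6) X(2)]) (use l that in simp)
          show False
          proof (cases "\<xi> b = 2")
            case True
            then have "E b u" using shared w'(2) by blast
            then show False using no4[of b z a'] w w' True l by auto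
          next
            case False
            \<comment> \<open>With equal signs only the exception remains, and it makes
              \<open>a2\<close> adjacent to both \<open>u\<close> and \<open>v\<close>.\<close>
            then obtain a1 a2 where aa: "E a1 y" "E a2 z" "\<xi> a1 = 2" "siblings E V \<kappa> a1 a2"
              using C5[OF Ab(2) w'(2) w(4) False ky kz yz] sy by blast
            have u1: "E a1 u" using shared aa by blast
            then have u2: "E a2 u" using sib[OF aa(4) Aa u1 X(1)] by blast
            then have "E a2 v" using shared'[OF aa(2)] \<xi>2 by blast
            then show False using C1[of a2 u v] u2 X uv(3) Aa by simp
          qed
        qed
        then have "n > 7" using n6 even by presburger
        moreover have "?c u \<le> 7" by (simp add: packing_color_def Let_def)
        ultimately show ?thesis by simp
      qed
    qed
  qed
qed

section \<open>Transfer to the given graph\<close>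

lemma awalk_relpow:
  assumes "pair_graph G" "pre_digraph.awalk (with_proj G) u p v"
  shows "(u, v) \<in> {(x, y). (x, y) \<in> parcs G} ^^ length p"
proof -
  interpret pair_graph G by fact
  have "(u, v) \<in> parcs G ^^ length p"
    using assms(2)
  proof (induction p arbitrary: u)
    case Nil
    then show ?case by (simp add: awalk_def)
  next
    case (Cons e p)
    then have "e \<in> parcs G" "fst e = u" "awalk (snd e) p v" by (auto simp: awalk_Cons_iff)
    then show ?case using Cons.IH[of "snd e"] relpow_Suc_I2[of u "snd e" "parcs G" v "length p"] by auto
  qed
  then show ?thesis by simp
qed

text \<open>If no arc led from \<open>S\<close> to the rest of \<open>U\<close>, everything
  reachable from a vertex of \<open>S\<close> in the symmetric closure would stay in
  \<open>S\<close>.\<close>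

lemma connected_cut:
  assumes "pair_graph G" "Digraph_Component.connected (with_proj G \<restriction> U)" 
    and S: "S \<noteq> {}" "S \<subset> U"
  shows "\<exists>a\<in>S. \<exists>b\<in>U - S. (a, b) \<in> parcs G"
proof (rule ccontr)
  interpret pair_graph G by fact
  assume no: "\<not> ?thesis"
  let ?H = "with_proj G \<restriction> U"
  obtain a b where ab: "a \<in> S" "b \<in> U" "b \<notin> S" using S by blast
  have "a \<rightarrow>\<^sup>*\<^bsub>with_proj (mk_symmetric ?H)\<^esub> b"
    using assms(2) ab S unfolding Digraph_Component.connected_def strongly_connected_def by auto
  then have "(a, b) \<in> (parcs (mk_symmetric ?H))\<^sup>*"
    by (auto simp: reachable_def dest: rtrancl_on_rtranclI)
  then have "b \<in> S"
  proof (induction rule: rtrancl_induct)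
    case (step y z)
    have "(y, z) \<in> parcs G" "y \<in> U" "z \<in> U"
      using step.hyps(2) pair_sym_arcs unfolding parcs_mk_symmetric
      by (auto simp: arcs_ends_def arc_to_ends_def symmetric_def sym_def)
    then show ?case using no step.IH by blast
  qed (use ab in simp)
  then show False using ab by simp
qed

theorem theorem1:
  fixes G :: "'a pair_pre_digraph"
  assumes "pair_graph G"
    and "k_connected 2 G"
    and "bipartite G"
    and "subcubic G"
    and "outerplanar G"
  shows "packing_chromatic_number G \<le> 7"
proof -
  interpret pair_graph G by fact
  define E where "E = (\<lambda>u v. (u, v) \<in> parcs G)"
  let ?V = "pverts G"
  have sym: "E u v \<Longrightarrow> E v u" for u v using arcs_symmetric unfolding E_def by blast
  have EV: "E u v \<Longrightarrow> u \<in> ?V \<and> v \<in> ?V \<and> u \<noteq> v" for u v 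
    using wellformed' pair_no_loops unfolding E_def by fastforce
  obtain U W where UW: "?V = U \<union> W" "U \<inter> W = {}" "parcs G \<subseteq> U \<times> W \<union> W \<times> U"
    using assms(3) unfolding bipartite_def by blast
  define A where "A = (\<lambda>v. v \<in> U)"
  have bip: "E u v \<Longrightarrow> A u \<noteq> A v" for u v using UW unfolding E_def A_def by blast
  have th: "\<not> theta E" using outerplanar_no_theta[OF assms(1,5)] unfolding E_def .
  have cut: "\<exists>a\<in>S. \<exists>b\<in>?V - X - S. E a b" if "X = {} \<or> (\<exists>x\<in>?V. X = {x})" "S \<noteq> {}" "S \<subset> ?V - X" for S X
  proof -
    have "X \<subseteq> ?V" "card X < 2" using that(1) by auto
    then have "Digraph_Component.connected (with_proj G \<restriction> (?V - X))" using assms(2) unfolding k_connected_def by blast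
    then show ?thesis using connected_cut[OF assms(1) _ that(2,3)] unfolding E_def by blast
  qed
  have "card ?V \<ge> 2" using assms(2) unfolding k_connected_def by simp
  then obtain xs where xs: "is_cycle E xs" "set xs = ?V"
    using hamiltonian_cycle[of ?V E, OF pair_finite_verts EV sym cut _ th] by blast
  have dist: "distinct xs" "length xs \<ge> 2" using xs(1) by (auto simp: is_cycle_def)
  let ?n = "length xs"
  have "\<exists>\<kappa> \<xi> s. good_labelling (\<lambda>i j. E (xs ! i) (xs ! j)) (\<lambda>i. A (xs ! i)) {..<?n} \<kappa> \<xi> s"
  proof (rule good_labelling_outer)
    show "card {y \<in> {..<?n}. E (xs ! x) (xs ! y)} \<le> 3" if "x \<in> {..<?n}" for x
    proof -
      have "card {y \<in> {..<?n}. E (xs ! x) (xs ! y)} \<le> card (out_arcs G (xs ! x))"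
        by (rule card_inj_on_le[of "\<lambda>y. (xs ! x, xs ! y)"])
          (auto simp: E_def inj_on_def nth_eq_iff_index_eq dist finite_out_arcs out_arcs_def)
      also have "\<dots> = out_degree G (xs ! x)" by (simp add: out_degree_def)
      also have "\<dots> \<le> 3" using assms(4) that xs(2) unfolding subcubic_def by auto
      finally show ?thesis .
    qed
    show "\<not> E (xs ! k) (xs ! l)" if "l \<in> {..<?n}" "i < k" "k < j" "j < l" "E (xs ! i) (xs ! j)" for i j k l
      using no_crossing_nth[of E A xs i k j l] sym th bip xs(1) that by auto
    show "E (xs ! x) (xs ! y)" if "x \<in> {..<?n}" "y \<in> {..<?n}" "x < y" "\<And>z. z \<in> {..<?n} \<Longrightarrow> z \<le> x \<or> y \<le> z" for x y
    proof -
      have "y = Suc x" using that(4)[of "Suc x"] that by auto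
      then show ?thesis using xs(1) that successively_nth[of E xs x] by (auto simp: is_cycle_def)
    qed
    have "Min {..<?n} = 0" "Max {..<?n} = ?n - 1" using dist(2) by (auto intro!: Min_eqI Max_eqI)
    moreover have "E (xs ! (?n - 1)) (xs ! 0)"
    proof -
      have "xs \<noteq> []" using dist(2) by auto
      then show ?thesis using xs(1) last_conv_nth[of xs] hd_conv_nth[of xs] by (simp add: is_cycle_def)
    qed
    ultimately show "E (xs ! Min {..<?n}) (xs ! Max {..<?n})" using sym by simp
  qed (use sym bip dist in auto)
  then obtain \<kappa> \<xi> s where good: "good_labelling E A ?V \<kappa> \<xi> s"
    using good_labelling_nth[OF _ dist(1)] xs(2) by metis
  define c where "c = packing_color E A \<kappa> \<xi> s"
  have far: "ereal (real (c u)) < graph_dist G u v" if uv: "u \<in> ?V" "v \<in> ?V" "u \<noteq> v" "c u = c v" for u v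
  proof -
    \<comment> \<open>The distance is an infimum over walks, so the strict inequality comes from the
      uniform integer bound \<open>Suc (c u)\<close>.\<close>
    have "ereal (real (Suc (c u))) \<le> \<mu> (\<lambda>_. 1) u v"
      unfolding \<mu>_def
    proof (rule INF_greatest)
      fix p assume "p \<in> {p. awalk u p v}"
      then have "(u, v) \<in> {(x, y). E x y} ^^ length p"
        using awalk_relpow[OF assms(1)] unfolding E_def by auto
      then have "c u < length p"
        unfolding c_def using packing_color_far[of E ?V A \<kappa> \<xi> s u v "length p"] EV sym bip good uv unfolding c_def by blast
      moreover have "awalk_cost (\<lambda>_. 1) p = real (length p)" by (simp add: awalk_cost_def sum_list_triv)
      ultimately show "ereal (real (Suc (c u))) \<le> ereal (awalk_cost (\<lambda>_. 1) p)" by simp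
    qed
    moreover have "ereal (real (c u)) < ereal (real (Suc (c u)))" by simp
    ultimately show ?thesis unfolding graph_dist_def by (metis less_le_trans)
  qed
  have "S_packing_coloring G 7 (\<lambda>i. i) c"
    unfolding S_packing_coloring_def d_packing_def
  proof (intro conjI ballI impI)
    show "c ` ?V \<subseteq> {1..7}" by (auto simp: c_def packing_color_def Let_def)
    show "graph_dist G u v > ereal (real i)" 
      if "i \<in> {1..7}" "u \<in> {v \<in> ?V. c v = i}" "v \<in> {v \<in> ?V. c v = i}" "u \<noteq> v" for i u v
      using far[of u v] that by auto
  qed auto
  then show ?thesis unfolding packing_chromatic_number_def by (intro Least_le) blast
qed

end
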